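(* Fix $\alpha\in(0,1)$, $T\ge 1$, a horizon $h\ge 1$, and consider the Bayesian dynamic panel Tobit model described in the context, with finite-dimensional homogeneous parameter $\vartheta=(\theta,\xi)$. For each $N$ let $C_{iT+h|T}(Y_{1:N,0:T})$, $i=1,\ldots,N$, be the posterior predictive set forecasts described in the context, with interval segments $[a_{ik,N},b_{ik,N}]$, $k=1,\ldots,K_i$ (endpoints and $K_i$ are functions of $Y_{1:N,0:T}$), and define $$F_{ik,N}(\vartheta)=\int_{a_{ik,N}}^{b_{ik,N}} p(y^*_{iT+h}\mid Y_{i,0:T},\vartheta)\,dy^*_{iT+h}.$$ Suppose that: (i) The future observations $Y_{1:N,T+h}$ are sampled from the predictive density $p(Y_{1:N,T+h}\mid Y_{1:N,0:T})$. (ii) The posterior distribution $p(\vartheta\mid Y_{1:N,0:T})$ has a unique mode $\bar\vartheta_N$. There exist a sequence of shrinking neighborhoods $\mathcal N_N(\bar\vartheta_N)$ with complements $\mathcal N_N^c(\bar\vartheta_N)$ and a sequence $\delta_N$ such that $\|\vartheta-\bar\vartheta_N\|\le\delta_N$ for all $\vartheta\in\mathcal N_N(\bar\vartheta_N)$ and $$\mathbb P^{\vartheta}_{Y_{1:N,0:T}}\{\vartheta\in\mathcal N^c_N(\bar\vartheta_N)\}\stackrel{p}{\longrightarrow}0,\qquad \delta_N\stackrel{p}{\longrightarrow}0$$ in $\mathbb P^{Y_{1:N,0:T}}$ probability as $N\to\infty$. (iii) The functions $F_{ik,N}(\vartheta)$ are locally Lipschitz in any compact neighborhood $\mathcal N_N(\vartheta)$,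 with Lipschitz constants $M_{ik,N}(\mathcal N_N(\vartheta))$. (iv) For some $M<\infty$ independent of $N$, $$\mathbb P^{Y_{1:N,0:T}}\left\{\frac1N\sum_{i=1}^N\sum_{k=1}^{K_i}M_{ik,N}(\mathcal N_N(\bar\vartheta_N))>M\right\}\longrightarrow 0 .$$ (v) The Bayesian coverage probability constraint holds with equality, i.e. either (pointwise) $\mathbb P^{y_{iT+h}}_{Y_{1:N,0:T}}\{y_{iT+h}\in C_{iT+h|T}(Y_{1:N,0:T})\}=1-\alpha$ for all $i$, or (average) $\frac1N\sum_{i=1}^N\mathbb P^{y_{iT+h}}_{Y_{1:N,0:T}}\{y_{iT+h}\in C_{iT+h|T}(Y_{1:N,0:T})\}=1-\alpha$. Then the empirical coverage frequency converges to the Bayesian credible level: $$\frac1N\sum_{i=1}^N\mathbb I\{y_{iT+h}\in C_{iT+h|T}(Y_{1:N,0:T})\}\stackrel{p}{\longrightarrow}1-\alpha$$ in $\mathbb P^{Y_{1:N,0:T},Y_{1:N,T+h}}$ probability as $N\to\infty$.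
   Context: Notation. Sequences $(a_1,\ldots,a_n)$ are abbreviated $a_{1:n}$; e.g. $Y_{1:N,0:T}$ collects $y_{it}$ for $i=1,\ldots,N$, $t=0,\ldots,T$, and $Y_{i,0:T}$ collects $y_{it}$, $t=0,\ldots,T$, for the single unit $i$. For $\mathbb P$ and $\mathbb E$, subscripts indicate the conditioning variables and superscripts the random variables over which one integrates; e.g. $\mathbb P^{\vartheta}_{Y_{1:N,0:T}}$ is the posterior of $\vartheta$, $\mathbb P^{y_{iT+h}}_{Y_{1:N,0:T}}$ is the posterior predictive distribution of $y_{iT+h}$, $\mathbb P^{Y_{1:N,0:T}}$ is the marginal distribution of the data under the Bayesian model (parameters integrated out under the prior), and $\mathbb P^{Y_{1:N,0:T},Y_{1:N,T+h}}$ is the joint marginal distribution of data and future observations. Model. For $i=1,\ldots,N$, $t=1,\ldots,T$, $$y_{it}=y_{it}^*\,\mathbb I\{y_{it}^*\ge 0\},\qquad y_{it}^*\mid(\text{past},\text{parameters})\stackrel{\text{indep}}{\sim}N(\lambda_i+\rho y^*_{it-1}+\beta'x_{it-1},\sigma_i^2),$$ independently across $i$, where $x_{it}$ are observed sequentially exogenous regressors; also $y_{i0}=y_{i0}^*\mathbb I\{y_{i0}^*\ge0\}$. The homogeneous parameter is $\theta=[\rho,\beta']'$. The unit-specific quantities $(\lambda_i,y_{i0}^*,\sigma_i^2)$ are independent across $i$ with correlated-random-effects density $p(\lambda_i,y_{i0}^*,\sigma_i^2\mid x_{i,-1},\xi)$, indexed by a finite-dimensional hyperparameter $\xi$ (the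 distributions of $(\lambda_i,y^*_{i0})$ given $x_{i,-1}$ and of $\ln\sigma_i^2$ are finite mixtures of Normals with a fixed maximum number of components). A prior $p(\theta)p(\xi)$ is placed on $\vartheta=(\theta,\xi)$. All distributions are conditional on the regressors, which are dropped from the notation. The Bayesian model gives a joint distribution that factors as $$p(Y_{1:N,0:T})\,p(\vartheta\mid Y_{1:N,0:T})\prod_{i=1}^N p(\lambda_i,\sigma_i^2\mid\vartheta,Y_{i,0:T})\,p(y_{iT+h}\mid\lambda_i,\sigma_i^2,\vartheta,Y_{i,0:T}),$$ so that, conditionally on $(Y_{1:N,0:T},\vartheta)$, the $y_{iT+h}$ are independent across $i$, and $p(y^*_{iT+h}\mid Y_{i,0:T},\vartheta)$ denotes the conditional density of the latent $y^*_{iT+h}$ (with $\lambda_i,\sigma_i^2$ and latent variables integrated out). The posterior predictive density $p(Y_{1:N,T+h}\mid Y_{1:N,0:T})$ is obtained by integrating $\vartheta$ out under $p(\vartheta\mid Y_{1:N,0:T})$. Its marginal for unit $i$ is a mixture of a point mass at $0$ and a continuous part: $$p(y_{iT+h}\mid Y_{1:N,0:T})=\mathbb P^{y_{iT+h}}_{Y_{1:N,0:T}}\{y_{iT+h}=0\}\,\delta_0(y_{iT+h})+p_c(y_{iT+h}\mid Y_{1:N,0:T})\,\mathbb I\{y_{iT+h}\ge0\}.$$ Set forecasts. They are of the form $$C_{iT+h|T}(Y_{1:N,0:T})=\{0\}\cup\Big(\bigcup_{k=1}^{K_i}[a_{ik,N},b_{ik,N}]\Big),\qquad a_{i1,N}<b_{i1,N}<a_{i2,N}<\cdots<a_{iK_i,N}<b_{iK_i,N},$$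 with $C_{iT+h|T}=\{0\}$ if $K_i=0$; $a_{i1,N}$ may equal $0$; when average coverage is targeted, $C_{iT+h|T}=\emptyset$ is also allowed for some $i$. They are constructed as highest posterior density sets $\{0\}\cup\{y\ge0: p_c(y\mid Y_{1:N,0:T})\ge\kappa\}$, with a unit-specific threshold $\kappa=\kappa_i$ when the coverage constraint $\mathbb P^{y_{iT+h}}_{Y_{1:N,0:T}}\{y_{iT+h}\in C_{iT+h|T}\}\ge1-\alpha$ is imposed for every $i$ (pointwise; $C_{iT+h|T}=\{0\}$ if the predictive probability of $0$ is at least $1-\alpha$), or with a threshold $\kappa$ common to all units when the constraint $\frac1N\sum_i\mathbb P^{y_{iT+h}}_{Y_{1:N,0:T}}\{y_{iT+h}\in C_{iT+h|T}\}\ge1-\alpha$ is imposed on average.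
   Formalization: In (iii) and (iv) the Lipschitz condition and the bounded average also cover a segment k=0 for each nonempty forecast, the probability of y_{iT+h}=0 given Y_{i,0:T} and ϑ; with k≥1 only, this term is uncontrolled and the claim can fail. *)

theory Defs
  imports "HOL-Probability.Probability"
begin

section \<open>The Bayesian dynamic panel Tobit model\<close>

text \<open>
  The finite-dimensional parameter of the model is \<open>\<phi> = (\<theta>, \<xi>)\<close> with \<open>\<theta> = (\<rho>, \<beta>)\<close>.  Units are numbered from 1.
  All laws are conditional on the regressors, which therefore enter as a fixed array;
  \<open>regressor P i t\<close> is \<open>x\<^sub>i\<^sub>t\<close>, where \<open>t = -1\<close> is the value that the correlated random effects
  are conditioned on.  \<open>re_density P x \<xi>\<close> is the density \<open>p(\<lambda>, y\<^sub>0\<^sup>*, \<sigma>\<^sup>2 | x, \<xi>)\<close>.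
\<close>

type_synonym ('b, 'x) par = "(real \<times> 'b) \<times> 'x"
type_synonym panel_data = "nat \<Rightarrow> nat \<Rightarrow> real"

record ('b, 'x) tobit_panel =
  last_obs :: nat
  horizon :: nat
  regressor :: "nat \<Rightarrow> int \<Rightarrow> 'b"
  re_density :: "'b \<Rightarrow> 'x \<Rightarrow> real \<times> real \<times> real \<Rightarrow> real"
  hyper_space :: "'x set"
  prior_theta :: "real \<times> 'b \<Rightarrow> real"
  prior_xi :: "'x \<Rightarrow> real"

definition param_space :: "('b, 'x) tobit_panel \<Rightarrow> ('b, 'x) par set" where
  "param_space P = UNIV \<times> hyper_space P"

definition prob_density :: "('a::euclidean_space \<Rightarrow> real) \<Rightarrow> bool" where
  "prob_density g \<longleftrightarrow> g \<in> borel_measurable borel \<and> (\<forall>u. 0 \<le> g u) \<and> (\<integral>\<^sup>+u. ennreal (g u) \<partial>lborel) = 1"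

definition binormal_density ::
  "real \<Rightarrow> real \<Rightarrow> real \<Rightarrow> real \<Rightarrow> real \<Rightarrow> real \<times> real \<Rightarrow> real" where
  "binormal_density m1 s1 m2 s2 r = (\<lambda>(u, v).
     exp (- (((u - m1) / s1)\<^sup>2 - 2 * r * ((u - m1) / s1) * ((v - m2) / s2) + ((v - m2) / s2)\<^sup>2)
            / (2 * (1 - r\<^sup>2)))
     / (2 * pi * s1 * s2 * sqrt (1 - r\<^sup>2)))"

definition normal_mixture :: "nat \<Rightarrow> (real \<Rightarrow> real) \<Rightarrow> bool" where
  "normal_mixture J g \<longleftrightarrow> (\<exists>w m s. (\<forall>k<J. 0 \<le> w k \<and> 0 < s k) \<and> (\<Sum>k<J. w k) = 1 \<and>
     g = (\<lambda>u. \<Sum>k<J. w k * normal_density (m k) (s k) u))"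

definition binormal_mixture :: "nat \<Rightarrow> (real \<times> real \<Rightarrow> real) \<Rightarrow> bool" where
  "binormal_mixture J g \<longleftrightarrow> (\<exists>w m1 s1 m2 s2 r.
     (\<forall>k<J. 0 \<le> w k \<and> 0 < s1 k \<and> 0 < s2 k \<and> \<bar>r k\<bar> < 1) \<and> (\<Sum>k<J. w k) = 1 \<and>
     g = (\<lambda>u. \<Sum>k<J. w k * binormal_density (m1 k) (s1 k) (m2 k) (s2 k) (r k) u))"

text \<open>
  Only hyperparameters in \<open>hyper_space P\<close> matter.  Outside it the random effects density has to be
  some probability density, merely so that every kernel below is total.  The number \<open>J\<close> of
  components is the same for all regressor values and hyperparameters (weights may be 0).
\<close>

definition tobit_model :: "('b::euclidean_space, 'x::euclidean_space) tobit_panel \<Rightarrow> bool" where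
  "tobit_model P \<longleftrightarrow>
     1 \<le> last_obs P \<and> 1 \<le> horizon P \<and>
     hyper_space P \<in> sets borel \<and>
     prob_density (prior_theta P) \<and> prob_density (prior_xi P) \<and>
     (\<forall>\<xi>. \<xi> \<notin> hyper_space P \<longrightarrow> prior_xi P \<xi> = 0) \<and>
     (\<forall>x. (\<lambda>(\<xi>, u). re_density P x \<xi> u) \<in> borel_measurable (borel \<Otimes>\<^sub>M borel)) \<and>
     (\<forall>x \<xi>. prob_density (re_density P x \<xi>)) \<and>
     (\<forall>x \<xi> l y0 s2. s2 \<le> 0 \<longrightarrow> re_density P x \<xi> (l, y0, s2) = 0) \<and>
     (\<exists>J. \<forall>\<xi>\<in>hyper_space P.
        (\<forall>x. \<exists>g. binormal_mixture J g \<and>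
           distr (density lborel (re_density P x \<xi>)) borel (\<lambda>(l, y0, s2). (l, y0)) = density lborel g) \<and>
        (\<exists>g. normal_mixture J g \<and> (\<forall>x.
           distr (density lborel (re_density P x \<xi>)) borel (\<lambda>(l, y0, s2). ln s2) = density lborel g)))"

definition prior :: "('b::euclidean_space, 'x::euclidean_space) tobit_panel \<Rightarrow> ('b, 'x) par measure" where
  "prior P = density lborel (\<lambda>(\<theta>, \<xi>). prior_theta P \<theta> * prior_xi P \<xi>)"

definition path_space :: "nat \<Rightarrow> (nat \<Rightarrow> real) measure" where
  "path_space n = Pi\<^sub>M {..n} (\<lambda>_. borel)"

definition tobit :: "real \<Rightarrow> real" where
  "tobit s = s * indicator {0..} s"

text \<open>
  Law of \<open>y\<^sub>0\<^sup>*, \<dots>, y\<^sub>n\<^sup>*\<close> given \<open>\<theta>\<close> and \<open>(\<lambda>, y\<^sub>0\<^sup>*, \<sigma>\<^sup>2)\<close>: given the past, the next latent value has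
  mean \<open>\<lambda> + \<rho> y\<^sub>n\<^sup>* + \<beta>'x\<^sub>n\<close> and variance \<open>\<sigma>\<^sup>2\<close>.  The same recursion generates the observed periods
  and the forecast horizon.
\<close>

primrec latent_law ::
  "(int \<Rightarrow> 'b::euclidean_space) \<Rightarrow> real \<times> 'b \<Rightarrow> real \<times> real \<times> real \<Rightarrow> nat \<Rightarrow> (nat \<Rightarrow> real) measure" where
  "latent_law x \<theta> u 0 = return (path_space 0) (\<lambda>t\<in>{..0}. fst (snd u))"
| "latent_law x \<theta> u (Suc n) = latent_law x \<theta> u n \<bind> (\<lambda>y.
     distr (density lborel (normal_density (fst u + fst \<theta> * y n + snd \<theta> \<bullet> x (int n)) (sqrt (snd (snd u)))))
       (path_space (Suc n)) (\<lambda>v. y(Suc n := v)))"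

definition unit_law ::
  "('b::euclidean_space, 'x::euclidean_space) tobit_panel \<Rightarrow> nat \<Rightarrow> ('b, 'x) par \<Rightarrow> (nat \<Rightarrow> real) measure" where
  "unit_law P i \<phi> = density lborel (re_density P (regressor P i (-1)) (snd \<phi>)) \<bind>
     (\<lambda>u. latent_law (regressor P i) (fst \<phi>) u (last_obs P + horizon P))"

definition observed :: "('b, 'x) tobit_panel \<Rightarrow> (nat \<Rightarrow> real) \<Rightarrow> nat \<Rightarrow> real" where
  "observed P y = (\<lambda>t\<in>{..last_obs P}. tobit (y t))"

definition data_space :: "('b, 'x) tobit_panel \<Rightarrow> nat \<Rightarrow> panel_data measure" where
  "data_space P N = Pi\<^sub>M {1..N} (\<lambda>_. path_space (last_obs P))"

definition unit_data_law ::
  "('b::euclidean_space, 'x::euclidean_space) tobit_panel \<Rightarrow> nat \<Rightarrow> ('b, 'x) par \<Rightarrow> (nat \<Rightarrow> real) measure" where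
  "unit_data_law P i \<phi> = distr (unit_law P i \<phi>) (path_space (last_obs P)) (observed P)"

definition data_law_given ::
  "('b::euclidean_space, 'x::euclidean_space) tobit_panel \<Rightarrow> nat \<Rightarrow> ('b, 'x) par \<Rightarrow> panel_data measure" where
  "data_law_given P N \<phi> = Pi\<^sub>M {1..N} (\<lambda>i. unit_data_law P i \<phi>)"

definition data_law ::
  "('b::euclidean_space, 'x::euclidean_space) tobit_panel \<Rightarrow> nat \<Rightarrow> panel_data measure" where
  "data_law P N = prior P \<bind> data_law_given P N"

section \<open>Posterior and posterior predictive distributions\<close>

text \<open>
  The next two predicates say that a function is a version of a conditional density; \<open>p Y \<phi>\<close> is
  \<open>p(\<phi> | Y)\<close>, and \<open>f Y \<phi> s\<close> is the density of \<open>y\<^sub>i\<^sub>T\<^sub>+\<^sub>h\<^sup>*\<close> at \<open>s\<close> given the data \<open>Y\<close> of unit \<open>i\<close> and \<open>\<phi>\<close>.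
\<close>

definition posterior_density ::
  "('b::euclidean_space, 'x::euclidean_space) tobit_panel \<Rightarrow> nat \<Rightarrow> (panel_data \<Rightarrow> ('b, 'x) par \<Rightarrow> real) \<Rightarrow> bool" where
  "posterior_density P N p \<longleftrightarrow>
     (\<lambda>(Y, \<phi>). p Y \<phi>) \<in> borel_measurable (data_space P N \<Otimes>\<^sub>M borel) \<and>
     (\<forall>Y\<in>space (data_space P N). prob_density (p Y) \<and> (\<forall>\<phi>. \<phi> \<notin> param_space P \<longrightarrow> p Y \<phi> = 0)) \<and>
     prior P \<bind> (\<lambda>\<phi>. distr (data_law_given P N \<phi>) (data_space P N \<Otimes>\<^sub>M borel) (\<lambda>Y. (Y, \<phi>))) =
     data_law P N \<bind> (\<lambda>Y. distr (density lborel (p Y)) (data_space P N \<Otimes>\<^sub>M borel) (\<lambda>\<phi>. (Y, \<phi>)))"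

definition unique_posterior_mode ::
  "('b, 'x) tobit_panel \<Rightarrow> (panel_data \<Rightarrow> ('b, 'x) par \<Rightarrow> real) \<Rightarrow> panel_data \<Rightarrow> bool" where
  "unique_posterior_mode P p Y \<longleftrightarrow> (\<exists>!\<phi>. is_arg_max (p Y) (\<lambda>\<phi>. \<phi> \<in> param_space P) \<phi>)"

definition posterior_mode ::
  "('b, 'x) tobit_panel \<Rightarrow> (panel_data \<Rightarrow> ('b, 'x) par \<Rightarrow> real) \<Rightarrow> panel_data \<Rightarrow> ('b, 'x) par" where
  "posterior_mode P p Y = arg_max_on (p Y) (param_space P)"

definition latent_forecast_density ::
  "('b::euclidean_space, 'x::euclidean_space) tobit_panel \<Rightarrow> nat \<Rightarrow>
   ((nat \<Rightarrow> real) \<Rightarrow> ('b, 'x) par \<Rightarrow> real \<Rightarrow> real) \<Rightarrow> bool" where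
  "latent_forecast_density P i f \<longleftrightarrow>
     (\<lambda>((Y, \<phi>), s). f Y \<phi> s) \<in> borel_measurable ((path_space (last_obs P) \<Otimes>\<^sub>M borel) \<Otimes>\<^sub>M borel) \<and>
     (\<forall>\<phi>. (\<forall>Y\<in>space (path_space (last_obs P)). prob_density (f Y \<phi>)) \<and>
       distr (unit_law P i \<phi>) (path_space (last_obs P) \<Otimes>\<^sub>M borel)
         (\<lambda>y. (observed P y, y (last_obs P + horizon P))) =
       unit_data_law P i \<phi> \<bind>
         (\<lambda>Y. distr (density lborel (f Y \<phi>)) (path_space (last_obs P) \<Otimes>\<^sub>M borel) (\<lambda>s. (Y, s))))"

text \<open>
  In what follows \<open>p\<close> is the posterior density for a panel of \<open>N\<close> units and \<open>f i\<close> the latent forecast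
  density of unit \<open>i\<close>.  Given the data and \<open>\<phi>\<close> the future observations are independent across units.
\<close>

definition predictive_law ::
  "nat \<Rightarrow> (panel_data \<Rightarrow> ('b::euclidean_space, 'x::euclidean_space) par \<Rightarrow> real) \<Rightarrow>
   (nat \<Rightarrow> (nat \<Rightarrow> real) \<Rightarrow> ('b, 'x) par \<Rightarrow> real \<Rightarrow> real) \<Rightarrow> panel_data \<Rightarrow> (nat \<Rightarrow> real) measure" where
  "predictive_law N p f Y = density lborel (p Y) \<bind>
     (\<lambda>\<phi>. Pi\<^sub>M {1..N} (\<lambda>i. distr (density lborel (f i (Y i) \<phi>)) borel tobit))"

definition unit_predictive_law ::
  "nat \<Rightarrow> (panel_data \<Rightarrow> ('b::euclidean_space, 'x::euclidean_space) par \<Rightarrow> real) \<Rightarrow>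
   (nat \<Rightarrow> (nat \<Rightarrow> real) \<Rightarrow> ('b, 'x) par \<Rightarrow> real \<Rightarrow> real) \<Rightarrow> nat \<Rightarrow> panel_data \<Rightarrow> real measure" where
  "unit_predictive_law N p f i Y = distr (predictive_law N p f Y) borel (\<lambda>y. y i)"

text \<open>The density \<open>p\<^sub>c\<close> of the continuous part; above 0 the latent and the observed value agree.\<close>

definition predictive_density_c ::
  "(panel_data \<Rightarrow> ('b::euclidean_space, 'x::euclidean_space) par \<Rightarrow> real) \<Rightarrow>
   (nat \<Rightarrow> (nat \<Rightarrow> real) \<Rightarrow> ('b, 'x) par \<Rightarrow> real \<Rightarrow> real) \<Rightarrow> nat \<Rightarrow> panel_data \<Rightarrow> real \<Rightarrow> ennreal" where
  "predictive_density_c p f i Y y = (\<integral>\<^sup>+\<phi>. ennreal (f i (Y i) \<phi> y * p Y \<phi>) \<partial>lborel)"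

text \<open>Joint law of the data and of future observations drawn from the predictive distribution.\<close>

definition data_future_law ::
  "('b::euclidean_space, 'x::euclidean_space) tobit_panel \<Rightarrow> nat \<Rightarrow> (panel_data \<Rightarrow> ('b, 'x) par \<Rightarrow> real) \<Rightarrow>
   (nat \<Rightarrow> (nat \<Rightarrow> real) \<Rightarrow> ('b, 'x) par \<Rightarrow> real \<Rightarrow> real) \<Rightarrow> (panel_data \<times> (nat \<Rightarrow> real)) measure" where
  "data_future_law P N p f = data_law P N \<bind>
     (\<lambda>Y. distr (predictive_law N p f Y) (data_space P N \<Otimes>\<^sub>M Pi\<^sub>M {1..N} (\<lambda>_. borel)) (\<lambda>y. (Y, y)))"

section \<open>Set forecasts\<close>

text \<open>
  \<open>void\<close> marks the empty forecast; otherwise the forecast is \<open>{0}\<close> together with the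
  intervals \<open>{lo S k..hi S k}\<close>, \<open>1 \<le> k \<le> n_seg S\<close>.
\<close>

record forecast =
  void :: bool
  n_seg :: nat
  lo :: "nat \<Rightarrow> real"
  hi :: "nat \<Rightarrow> real"

definition forecast_set :: "forecast \<Rightarrow> real set" where
  "forecast_set S = (if void S then {} else {0} \<union> (\<Union>k\<in>{1..n_seg S}. {lo S k..hi S k}))"

definition valid_forecast :: "forecast \<Rightarrow> bool" where
  "valid_forecast S \<longleftrightarrow> (void S \<longrightarrow> n_seg S = 0) \<and> (1 \<le> n_seg S \<longrightarrow> 0 \<le> lo S 1) \<and>
     (\<forall>k\<in>{1..n_seg S}. lo S k < hi S k) \<and> (\<forall>k\<in>{1..<n_seg S}. hi S k < lo S (Suc k))"

text \<open>
  The latent values whose observed value lies in a nonempty forecast are those in segments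
  \<open>0, \<dots>, n_seg S\<close>, where segment 0 is the half-line that is censored to the atom \<open>{0}\<close>.
  Given the data and \<open>\<phi>\<close>, the coverage probability of a unit is thus the sum of \<open>F\<^sub>i\<^sub>k\<close> over
  \<open>segments S\<close>, the term \<open>k = 0\<close> being the predictive probability of the atom.
\<close>

definition segments :: "forecast \<Rightarrow> nat set" where
  "segments S = (if void S then {} else {0..n_seg S})"

definition latent_segment :: "forecast \<Rightarrow> nat \<Rightarrow> real set" where
  "latent_segment S k = (if k = 0 then {..0} else {lo S k..hi S k})"

text \<open>The function \<open>F\<^sub>i\<^sub>k\<close> for a unit with data \<open>Yi\<close>, latent forecast density \<open>fi\<close> and forecast \<open>S\<close>.\<close>

definition segment_prob ::
  "((nat \<Rightarrow> real) \<Rightarrow> ('b, 'x) par \<Rightarrow> real \<Rightarrow> real) \<Rightarrow> (nat \<Rightarrow> real) \<Rightarrow> forecast \<Rightarrow> nat \<Rightarrow> ('b, 'x) par \<Rightarrow> real" where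
  "segment_prob fi Yi S k \<phi> = (LINT s:latent_segment S k|lborel. fi Yi \<phi> s)"

definition measurable_forecast :: "'a measure \<Rightarrow> ('a \<Rightarrow> forecast) \<Rightarrow> bool" where
  "measurable_forecast D S \<longleftrightarrow>
     (\<lambda>Y. void (S Y)) \<in> measurable D (count_space UNIV) \<and>
     (\<lambda>Y. n_seg (S Y)) \<in> measurable D (count_space UNIV) \<and>
     (\<forall>k. (\<lambda>Y. lo (S Y) k) \<in> borel_measurable D) \<and>
     (\<forall>k. (\<lambda>Y. hi (S Y) k) \<in> borel_measurable D)"

datatype coverage_target = Pointwise | Average

definition hpd_set :: "(real \<Rightarrow> ennreal) \<Rightarrow> real \<Rightarrow> real set" where
  "hpd_set pc \<kappa> = {0} \<union> {y. 0 \<le> y \<and> ennreal \<kappa> \<le> pc y}"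

text \<open>Construction of the forecasts \<open>S i\<close>, \<open>1 \<le> i \<le> N\<close>, from the predictive distribution at data \<open>Y\<close>.\<close>

fun hpd_forecasts ::
  "coverage_target \<Rightarrow> real \<Rightarrow> nat \<Rightarrow> (panel_data \<Rightarrow> ('b::euclidean_space, 'x::euclidean_space) par \<Rightarrow> real) \<Rightarrow>
   (nat \<Rightarrow> (nat \<Rightarrow> real) \<Rightarrow> ('b, 'x) par \<Rightarrow> real \<Rightarrow> real) \<Rightarrow> panel_data \<Rightarrow> (nat \<Rightarrow> forecast) \<Rightarrow> bool" where
  "hpd_forecasts Pointwise \<alpha> N p f Y S \<longleftrightarrow> (\<forall>i\<in>{1..N}. valid_forecast (S i) \<and> \<not> void (S i) \<and>
     (if 1 - \<alpha> \<le> measure (unit_predictive_law N p f i Y) {0} then forecast_set (S i) = {0}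
      else \<exists>\<kappa>. forecast_set (S i) = hpd_set (predictive_density_c p f i Y) \<kappa>))"
| "hpd_forecasts Average \<alpha> N p f Y S \<longleftrightarrow> (\<exists>\<kappa>. \<forall>i\<in>{1..N}. valid_forecast (S i) \<and>
     (void (S i) \<or> forecast_set (S i) = hpd_set (predictive_density_c p f i Y) \<kappa>))"

fun coverage_equality ::
  "coverage_target \<Rightarrow> real \<Rightarrow> nat \<Rightarrow> (panel_data \<Rightarrow> ('b::euclidean_space, 'x::euclidean_space) par \<Rightarrow> real) \<Rightarrow>
   (nat \<Rightarrow> (nat \<Rightarrow> real) \<Rightarrow> ('b, 'x) par \<Rightarrow> real \<Rightarrow> real) \<Rightarrow> panel_data \<Rightarrow> (nat \<Rightarrow> forecast) \<Rightarrow> bool" where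
  "coverage_equality Pointwise \<alpha> N p f Y S \<longleftrightarrow>
     (\<forall>i\<in>{1..N}. measure (unit_predictive_law N p f i Y) (forecast_set (S i)) = 1 - \<alpha>)"
| "coverage_equality Average \<alpha> N p f Y S \<longleftrightarrow>
     (\<Sum>i\<in>{1..N}. measure (unit_predictive_law N p f i Y) (forecast_set (S i))) / real N = 1 - \<alpha>"

definition coverage_frequency :: "nat \<Rightarrow> (nat \<Rightarrow> forecast) \<Rightarrow> (nat \<Rightarrow> real) \<Rightarrow> real" where
  "coverage_frequency N S y = (\<Sum>i\<in>{1..N}. indicator (forecast_set (S i)) (y i)) / real N"

section \<open>Convergence in probability and neighborhoods\<close>

text \<open>Convergence to a constant of random variables on varying probability spaces.\<close>

definition conv_in_prob :: "(nat \<Rightarrow> 'a measure) \<Rightarrow> (nat \<Rightarrow> 'a \<Rightarrow> real) \<Rightarrow> real \<Rightarrow> bool" where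
  "conv_in_prob M X c \<longleftrightarrow> (\<forall>\<^sub>F n in sequentially. X n \<in> borel_measurable (M n)) \<and>
     (\<forall>\<epsilon>>0. (\<lambda>n. measure (M n) {\<omega> \<in> space (M n). \<bar>X n \<omega> - c\<bar> > \<epsilon>}) \<longlonglongrightarrow> 0)"

text \<open>Neighborhoods are relative to the parameter space \<open>\<Theta>\<close>, which need not be open.\<close>

definition compact_neighborhood :: "'a::topological_space set \<Rightarrow> 'a \<Rightarrow> 'a set \<Rightarrow> bool" where
  "compact_neighborhood \<Theta> \<phi> B \<longleftrightarrow> compact B \<and> B \<subseteq> \<Theta> \<and> (\<exists>U. open U \<and> \<phi> \<in> U \<and> \<phi> \<in> \<Theta> \<and> U \<inter> \<Theta> \<subseteq> B)"

end

theory Submission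
  imports Defs "HOL-Real_Asymp.Real_Asymp"
begin

text \<open>
  Given the data and the parameter \<open>\<phi>\<close> the coverage indicators are independent, so by Hoeffding's
  inequality the coverage frequency is close to its conditional mean \<open>q(\<phi>)\<close>, the average over
  units of sums of the \<open>F\<^sub>i\<^sub>k\<close>.  The posterior mean of \<open>q\<close> is \<open>1 - \<alpha>\<close> by the coverage constraint,
  and \<open>q\<close> varies by at most \<open>avg_L \<cdot> \<delta>\<close> on the neighborhood of the mode.  As \<open>0 \<le> q \<le> 1\<close>, the
  posterior mass outside contributes at most itself, whence \<open>q(\<phi>)\<close> is within twice the variation plus
  that mass of \<open>1 - \<alpha>\<close> on the neighborhood.  All bounds are uniform over data outside an event
  of vanishing probability.
\<close>

section \<open>Measurable kernels, and the total mass of a \<open>bind\<close>\<close>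

text \<open>A map into probability measures is measurable once the mass of every set of an
  intersection-stable generator is. For finite \<open>I\<close> the boxes form such a generator, and
  the mass of a box is a finite product of measurable functions.\<close>

lemma measurable_PiM_prob_algebra:
  assumes I: "finite I"
    and K: "\<And>i. i \<in> I \<Longrightarrow> K i \<in> M \<rightarrow>\<^sub>M prob_algebra (N i)"
  shows "(\<lambda>x. Pi\<^sub>M I (\<lambda>i. K i x)) \<in> M \<rightarrow>\<^sub>M prob_algebra (Pi\<^sub>M I N)"
proof (rule measurable_prob_algebra_generated)
  show "sets (Pi\<^sub>M I N) = sigma_sets (space (Pi\<^sub>M I N)) {Pi\<^sub>E I E | E. \<forall>i\<in>I. E i \<in> sets (N i)}"
    using prod_algebra_eq_finite[OF I, of N] by (simp add: sets_PiM space_PiM Pi_iff)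
  show "Int_stable {Pi\<^sub>E I E | E. \<forall>i\<in>I. E i \<in> sets (N i)}"
    by (rule Int_stable_PiE)
  show "{Pi\<^sub>E I E | E. \<forall>i\<in>I. E i \<in> sets (N i)} \<subseteq> Pow (space (Pi\<^sub>M I N))"
    using sets.sets_into_space by (fastforce simp: space_PiM PiE_iff)
next
  fix x assume x: "x \<in> space M"
  have prob: "prob_space (K i x)" and sets_K: "sets (K i x) = sets (N i)" if "i \<in> I" for i
    using measurable_space[OF K[OF that] x] by (auto simp: space_prob_algebra)
  show "prob_space (Pi\<^sub>M I (\<lambda>i. K i x))"
    by (rule prob_space_PiM) (rule prob)
  show "sets (Pi\<^sub>M I (\<lambda>i. K i x)) = sets (Pi\<^sub>M I N)"
    by (rule sets_PiM_cong) (auto simp: sets_K)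
next
  fix A assume "A \<in> {Pi\<^sub>E I E | E. \<forall>i\<in>I. E i \<in> sets (N i)}"
  then obtain E where A: "A = Pi\<^sub>E I E" and E: "\<And>i. i \<in> I \<Longrightarrow> E i \<in> sets (N i)" by auto
  have "emeasure (Pi\<^sub>M I (\<lambda>i. K i x)) A = (\<Prod>i\<in>I. emeasure (K i x) (E i))" if x: "x \<in> space M" for x
  proof -
    have "prob_space (K i x)" "sets (K i x) = sets (N i)" if "i \<in> I" for i
      using measurable_space[OF K[OF that] x] by (auto simp: space_prob_algebra)
    then show ?thesis
      using emeasure_PiM_emb[of I "\<lambda>i. K i x" I E] I E
      by (simp add: A prod_emb_PiE_same_index sets.sets_into_space[of _ "K _ x"])
  qed
  moreover have "(\<lambda>x. \<Prod>i\<in>I. emeasure (K i x) (E i)) \<in> borel_measurable M"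
    by (intro borel_measurable_prod_ennreal)
       (rule measurable_compose[OF measurable_prob_algebraD[OF K] measurable_emeasure_subprob_algebra[OF E]])
  ultimately show "(\<lambda>x. emeasure (Pi\<^sub>M I (\<lambda>i. K i x)) A) \<in> borel_measurable M"
    by (simp cong: measurable_cong)
qed

lemma prob_space_density_lborel: "prob_density g \<Longrightarrow> prob_space (density lborel g)"
  by (auto simp: prob_density_def intro!: prob_spaceI simp: emeasure_density)

text \<open>The mass of a fixed set is the integral over \<open>u\<close> of a jointly measurable
  function, hence measurable in \<open>x\<close>. This turns posterior and latent forecast densities
  into kernels.\<close>

lemma measurable_density_lborel:
  fixes g :: "'a \<Rightarrow> 'b::euclidean_space \<Rightarrow> real"
  assumes g[measurable]: "(\<lambda>(x, u). g x u) \<in> borel_measurable (M \<Otimes>\<^sub>M borel)"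
    and prob: "\<And>x. x \<in> space M \<Longrightarrow> prob_density (g x)"
  shows "(\<lambda>x. density lborel (g x)) \<in> M \<rightarrow>\<^sub>M prob_algebra borel"
proof (rule measurable_prob_algebra_generated[where \<Omega>=UNIV and G="sets borel"])
  show "prob_space (density lborel (g x))" if "x \<in> space M" for x
    using prob[OF that] by (rule prob_space_density_lborel)
  fix A :: "'b set" assume A[measurable]: "A \<in> sets borel"
  have g'[measurable]: "(\<lambda>(x, u). g x u) \<in> borel_measurable (M \<Otimes>\<^sub>M lborel)"
    by simp
  have "emeasure (density lborel (g x)) A = (\<integral>\<^sup>+u. ennreal (g x u) * indicator A u \<partial>lborel)"
    if "x \<in> space M" for x
    using prob[OF that] by (subst emeasure_density) (auto simp: prob_density_def)
  moreover have "(\<lambda>x. \<integral>\<^sup>+u. ennreal (g x u) * indicator A u \<partial>lborel) \<in> borel_measurable M"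
    by measurable
  ultimately show "(\<lambda>x. emeasure (density lborel (g x)) A) \<in> borel_measurable M"
    by (simp cong: measurable_cong)
qed (auto simp: Int_stable_def sets.sigma_sets_eq[of borel, simplified])

text \<open>If \<open>K\<close> is not measurable, the \<open>distr\<close> inside \<open>bind\<close> is at worst the zero measure, so the bound survives.\<close>

lemma emeasure_bind_space_le:
  assumes "space M \<noteq> {}" "\<And>x. x \<in> space M \<Longrightarrow> subprob_space (K x)" "\<And>x. x \<in> space M \<Longrightarrow> sets (K x) = sets N"
  shows "emeasure (bind M K) (space (bind M K)) \<le> emeasure M (space M)"
proof -
  define D where "D = distr M (subprob_algebra N) K"
  \<comment> \<open>\<open>bind\<close> takes its target space from the kernel at an arbitrarily
    chosen point; since all \<open>K x\<close> carry the sets of \<open>N\<close>, the choice is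
    immaterial.\<close>
  have eq: "subprob_algebra (K (SOME x. x \<in> space M)) = subprob_algebra N"
    using assms by (intro subprob_algebra_cong) (auto simp: some_in_eq)
  have bind: "bind M K = join D"
    using assms eq by (simp add: bind_def D_def)
  have D: "sets D = sets (subprob_algebra N)" by (simp add: D_def)
  have "emeasure (join D) (space N) = (\<integral>\<^sup>+ M'. emeasure M' (space N) \<partial>D)"
    using D by (rule emeasure_join) simp
  also have "\<dots> \<le> (\<integral>\<^sup>+ M'. 1 \<partial>D)"
    using D by (intro nn_integral_mono)
      (auto simp: D_def space_subprob_algebra intro!: subprob_space.subprob_emeasure_le_1)
  also have "\<dots> = emeasure D (space D)" by simp
  also have "\<dots> \<le> emeasure M (space M)"
    unfolding D_def distr_def by (auto simp: emeasure_measure_of_conv intro: emeasure_space)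
  also have "space N = space (join D)"
    using D by (simp add: space_join)
  finally show ?thesis
    unfolding bind .
qed


section \<open>Hoeffding concentration for products and their mixtures\<close>

text \<open>Independence means that the joint law of the coordinates is the product of their
  marginals. Points of the product are extensional, so restricting to \<open>I\<close> changes
  nothing and the joint law is the product measure itself, with marginals
  \<open>K i\<close>.\<close>

lemma indep_vars_PiM_coordinates:
  assumes I: "I \<noteq> {}" and K: "\<And>i. i \<in> I \<Longrightarrow> prob_space (K i)"
  shows "prob_space.indep_vars (Pi\<^sub>M I K) K (\<lambda>i y. y i) I"
proof -
  interpret prob_space "Pi\<^sub>M I K"
    by (rule prob_space_PiM) (rule K)
  have "distr (Pi\<^sub>M I K) (Pi\<^sub>M I K) (\<lambda>y. \<lambda>i\<in>I. y i) = distr (Pi\<^sub>M I K) (Pi\<^sub>M I K) (\<lambda>y. y)"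
    by (rule distr_cong) (auto simp: space_PiM PiE_iff extensional_restrict)
  also have "\<dots> = (\<Pi>\<^sub>M i\<in>I. distr (Pi\<^sub>M I K) (K i) (\<lambda>y. y i))"
    unfolding distr_id by (rule PiM_cong) (simp_all add: distr_PiM_component K)
  finally show ?thesis
    by (subst indep_vars_iff_distr_eq_PiM') (use I in auto)
qed

lemma Hoeffding_indicators_PiM:
  fixes \<epsilon> :: real
  assumes I: "finite I" "I \<noteq> {}" and K: "\<And>i. i \<in> I \<Longrightarrow> prob_space (K i)"
    and A: "\<And>i. i \<in> I \<Longrightarrow> A i \<in> sets (K i)" and \<epsilon>: "0 \<le> \<epsilon>"
  shows "measure (Pi\<^sub>M I K) {y \<in> space (Pi\<^sub>M I K).
      \<epsilon> \<le> \<bar>(\<Sum>i\<in>I. indicator (A i) (y i)) / card I - (\<Sum>i\<in>I. measure (K i) (A i)) / card I\<bar>}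
    \<le> 2 * exp (- 2 * real (card I) * \<epsilon>\<^sup>2)"
proof -
  interpret prob_space "Pi\<^sub>M I K"
    by (rule prob_space_PiM) (rule K)
  define X where "X i y = (indicator (A i) (y i) :: real)" for i and y :: "'a \<Rightarrow> 'b"
  have E: "expectation (X i) = measure (K i) (A i)" if i: "i \<in> I" for i
  proof -
    have "expectation (X i) = integral\<^sup>L (distr (Pi\<^sub>M I K) (K i) (\<lambda>y. y i)) (indicator (A i) :: _ \<Rightarrow> real)"
      unfolding X_def using A[OF i] i by (subst integral_distr) auto
    also have "\<dots> = measure (K i) (A i)"
      using A[OF i] i K by (simp add: distr_PiM_component sets.sets_into_space Int_absorb2)
    finally show ?thesis .
  qed
  have "indep_vars (\<lambda>_. borel) X I"
    unfolding X_def[abs_def] using A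
    by (intro indep_vars_compose2[OF indep_vars_PiM_coordinates[OF I(2) K], where Y="\<lambda>i. indicator (A i)"]) auto
  then interpret Hoeffding_ineq "Pi\<^sub>M I K" I X "\<lambda>_. 0" "\<lambda>_. 1" "\<Sum>i\<in>I. expectation (X i)"
    by unfold_locales (auto simp: X_def I indicator_def)
  have n: "0 < real (card I)"
    using I by (simp add: card_gt_0_iff)
  \<comment> \<open>With \<open>n = card I\<close>, passing from means to sums scales the threshold
    to \<open>n * \<epsilon>\<close>. The squared ranges sum to \<open>n\<close>, so the exponent is
    \<open>- 2 * (n * \<epsilon>)\<^sup>2 / n = - 2 * n * \<epsilon>\<^sup>2\<close>.\<close>
  have "{y \<in> space (Pi\<^sub>M I K). \<epsilon> \<le> \<bar>(\<Sum>i\<in>I. X i y) / card I - (\<Sum>i\<in>I. expectation (X i)) / card I\<bar>}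
      = {y \<in> space (Pi\<^sub>M I K). \<epsilon> * card I \<le> \<bar>(\<Sum>i\<in>I. X i y) - (\<Sum>i\<in>I. expectation (X i))\<bar>}"
    using n by (simp add: diff_divide_distrib[symmetric] pos_le_divide_eq)
  moreover have "prob \<dots> \<le> 2 * exp (- 2 * (\<epsilon> * card I)\<^sup>2 / (\<Sum>i\<in>I. (1 - 0)\<^sup>2))"
    using \<epsilon> n by (intro Hoeffding_ineq_abs_ge) auto
  ultimately show ?thesis
    using n by (simp add: X_def E power2_eq_square algebra_simps)
qed

text \<open>Here \<open>u\<close> is a random parameter with law \<open>\<pi>\<close> and
  \<open>u0\<close> a reference point in the good set \<open>B\<close>. Two errors add up in the
  bound: draws of \<open>u\<close> outside \<open>B\<close>, and the Hoeffding deviation given a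
  \<open>u\<close> in \<open>B\<close>. The centring term averages the marginals of
  \<open>Q\<close>, which makes it the \<open>\<pi>\<close>-mean of \<open>q\<close>.\<close>

lemma mixture_frequency_concentration:
  fixes \<epsilon> :: real
  assumes \<pi>: "prob_space \<pi>"
    and I: "finite I" "I \<noteq> {}"
    and K: "\<And>i. i \<in> I \<Longrightarrow> K i \<in> \<pi> \<rightarrow>\<^sub>M prob_algebra (N i)"
    and A: "\<And>i. i \<in> I \<Longrightarrow> A i \<in> sets (N i)"
    and B: "B \<in> sets \<pi>" "u0 \<in> B"
    and q: "\<And>u. q u = (\<Sum>i\<in>I. measure (K i u) (A i)) / card I"
    and r: "\<And>u. u \<in> B \<Longrightarrow> \<bar>q u - q u0\<bar> \<le> r"
    and \<epsilon>: "2 * r + measure \<pi> (space \<pi> - B) \<le> \<epsilon> / 2" "0 \<le> \<epsilon>"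
  defines "Q \<equiv> \<pi> \<bind> (\<lambda>u. Pi\<^sub>M I (\<lambda>i. K i u))"
  shows "measure Q {y \<in> space (Pi\<^sub>M I N).
      \<epsilon> < \<bar>(\<Sum>i\<in>I. indicator (A i) (y i)) / card I
           - (\<Sum>i\<in>I. measure Q {y \<in> space (Pi\<^sub>M I N). y i \<in> A i}) / card I\<bar>}
    \<le> measure \<pi> (space \<pi> - B) + 2 * exp (- real (card I) * \<epsilon>\<^sup>2 / 2)"
proof -
  interpret prob_space \<pi> by (rule \<pi>)
  let ?K = "\<lambda>u. Pi\<^sub>M I (\<lambda>i. K i u)"
  have n: "0 < real (card I)"
    using I by (simp add: card_gt_0_iff)
  have KP: "?K \<in> \<pi> \<rightarrow>\<^sub>M prob_algebra (Pi\<^sub>M I N)"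
    by (rule measurable_PiM_prob_algebra[OF I(1) K])
  have \<pi>_in: "\<pi> \<in> space (prob_algebra \<pi>)"
    by (simp add: space_prob_algebra \<pi>)
  interpret Q: prob_space Q
    unfolding Q_def by (rule prob_space_bind'[OF \<pi>_in KP])
  have prob_K: "prob_space (K i u)" and sets_K: "sets (K i u) = sets (N i)" if "i \<in> I" "u \<in> space \<pi>" for i u
    using measurable_space[OF K[OF that(1)] that(2)] by (auto simp: space_prob_algebra)
  have prob_KP: "prob_space (?K u)" and sets_KP: "sets (?K u) = sets (Pi\<^sub>M I N)" if "u \<in> space \<pi>" for u
    using measurable_space[OF KP that] by (auto simp: space_prob_algebra)
  have space_KP: "space (?K u) = space (Pi\<^sub>M I N)" if "u \<in> space \<pi>" for u
    using sets_KP[OF that] by (rule sets_eq_imp_space_eq)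
  have Q: "measure Q X = (\<integral>u. measure (?K u) X \<partial>\<pi>)" if "X \<in> sets (Pi\<^sub>M I N)" for X
    unfolding Q_def by (rule measure_bind[OF measurable_prob_algebraD[OF KP] that])
  have meas: "(\<lambda>u. measure (?K u) X) \<in> borel_measurable \<pi>" if "X \<in> sets (Pi\<^sub>M I N)" for X
    by (rule measurable_compose[OF KP measurable_measure_prob_algebra[OF that]])
  \<comment> \<open>For fixed \<open>u\<close> the \<open>i\<close>-th marginal of the product is
    \<open>K i u\<close>, so the marginal of the mixture is the mixture of these marginals.\<close>
  have Q_component: "measure Q {y \<in> space (Pi\<^sub>M I N). y i \<in> A i} = (\<integral>u. measure (K i u) (A i) \<partial>\<pi>)"
    if i: "i \<in> I" for i
  proof -
    have "{y \<in> space (Pi\<^sub>M I N). y i \<in> A i} \<in> sets (Pi\<^sub>M I N)"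
      using i A by (intro sets_Collect_single') (auto simp: sets.Int_space_eq1 Int_def[symmetric])
    moreover have "measure (?K u) {y \<in> space (Pi\<^sub>M I N). y i \<in> A i} = measure (K i u) (A i)" if u: "u \<in> space \<pi>" for u
    proof -
      have "measure (K i u) (A i) = measure (distr (?K u) (K i u) (\<lambda>y. y i)) (A i)"
        using prob_K u i by (subst distr_PiM_component) auto
      also have "\<dots> = measure (?K u) {y \<in> space (Pi\<^sub>M I N). y i \<in> A i}"
        using sets_K[OF i u] A[OF i] i space_KP[OF u]
        by (subst measure_distr) (auto intro!: arg_cong[where f="measure _"])
      finally show ?thesis ..
    qed
    ultimately show ?thesis
      by (subst Q) (auto intro: Bochner_Integration.integral_cong)
  qed
  have int_K: "integrable \<pi> (\<lambda>u. measure (K i u) (A i))" if i: "i \<in> I" for i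
    using prob_K[OF i]
    by (intro integrable_const_bound[where B=1] AE_I2
        measurable_compose[OF K[OF i] measurable_measure_prob_algebra[OF A[OF i]]])
       (auto intro!: prob_space.prob_le_1)
  define c where "c = (\<Sum>i\<in>I. measure Q {y \<in> space (Pi\<^sub>M I N). y i \<in> A i}) / card I"
  have c: "c = (\<integral>u. q u \<partial>\<pi>)"
    unfolding c_def q using int_K by (simp add: Q_component Bochner_Integration.integral_sum)
  have int_q: "integrable \<pi> q"
    unfolding q[abs_def] using int_K by simp
  have q01: "0 \<le> q u \<and> q u \<le> 1" if "u \<in> space \<pi>" for u
  proof -
    have "(\<Sum>i\<in>I. measure (K i u) (A i)) \<le> card I"
      using sum_mono[of I "\<lambda>i. measure (K i u) (A i)" "\<lambda>_. 1"] prob_K[OF _ that] prob_space.prob_le_1 by fastforce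
    then show ?thesis using n by (simp add: q sum_nonneg)
  qed
  have u0: "u0 \<in> space \<pi>"
    using B sets.sets_into_space by blast
  have int_B: "integrable \<pi> (indicator (space \<pi> - B) :: _ \<Rightarrow> real)"
    using B by (intro integrable_real_indicator) (auto simp: less_top[symmetric])
  \<comment> \<open>As \<open>\<pi>\<close> has mass 1, \<open>c - q u0\<close> is the mean of
    \<open>q u - q u0\<close>, whose absolute value is at most \<open>r\<close> on \<open>B\<close>
    and at most 1 elsewhere.\<close>
  have "\<bar>c - q u0\<bar> = \<bar>\<integral>u. q u - q u0 \<partial>\<pi>\<bar>"
    using int_q by (simp add: c prob_space)
  also have "\<dots> \<le> (\<integral>u. \<bar>q u - q u0\<bar> \<partial>\<pi>)"
    by (rule integral_abs_bound)
  also have "\<dots> \<le> (\<integral>u. r + indicator (space \<pi> - B) u \<partial>\<pi>)"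
  proof (rule integral_mono)
    fix u assume u: "u \<in> space \<pi>"
    \<comment> \<open>Applied at \<open>u0\<close> itself, \<open>r\<close> gives
      \<open>0 \<le> r\<close>, so off \<open>B\<close> the bound 1 lies below
      \<open>r + 1\<close>.\<close>
    show "\<bar>q u - q u0\<bar> \<le> r + indicator (space \<pi> - B) u"
      using r[of u] r[OF B(2)] q01[OF u] q01[OF u0] u by (auto simp: indicator_def)
  qed (use int_q int_B in auto)
  also have "\<dots> = r + measure \<pi> (space \<pi> - B)"
    by (subst Bochner_Integration.integral_add[OF _ int_B]) (auto simp: prob_space Int_absorb2)
  finally have c_q0: "\<bar>c - q u0\<bar> \<le> r + measure \<pi> (space \<pi> - B)" .
  define W where "W = {y \<in> space (Pi\<^sub>M I N). \<epsilon> < \<bar>(\<Sum>i\<in>I. indicator (A i) (y i)) / card I - c\<bar>}"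
  have meas_ind: "(\<lambda>y. indicator (A i) (y i) :: real) \<in> borel_measurable (Pi\<^sub>M I N)" if "i \<in> I" for i
    using that A by (intro measurable_compose[OF measurable_component_singleton]) auto
  then have [measurable]: "W \<in> sets (Pi\<^sub>M I N)"
    unfolding W_def by measurable
  have W: "measure (?K u) W \<le> 2 * exp (- real (card I) * \<epsilon>\<^sup>2 / 2)" if u: "u \<in> B" for u
  proof -
    have u': "u \<in> space \<pi>"
      using u B sets.sets_into_space by blast
    interpret u: prob_space "?K u" by (rule prob_KP[OF u'])
    \<comment> \<open>The detour through \<open>q u0\<close> costs \<open>r\<close> once directly,
      and \<open>r\<close> plus the outside mass through \<open>c_q0\<close>; their sum is the left
      side of the hypothesis on \<open>\<epsilon>\<close>. The other \<open>\<epsilon> / 2\<close>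
      is left to Hoeffding's inequality.\<close>
    have qc: "\<bar>q u - c\<bar> \<le> \<epsilon> / 2"
      using r[OF u] c_q0 \<epsilon> by linarith
    let ?V = "{y \<in> space (?K u). \<epsilon> / 2 \<le> \<bar>(\<Sum>i\<in>I. indicator (A i) (y i)) / card I - q u\<bar>}"
    have "\<epsilon> / 2 \<le> \<bar>a - q u\<bar>" if "\<epsilon> < \<bar>a - c\<bar>" for a
      using that qc by linarith
    then have "W \<subseteq> ?V"
      unfolding W_def space_KP[OF u'] by blast
    moreover have "?V \<in> sets (?K u)"
      unfolding space_KP[OF u'] sets_KP[OF u'] using meas_ind by measurable
    ultimately have "measure (?K u) W \<le> measure (?K u) ?V"
      by (rule u.finite_measure_mono)
    also have "\<dots> \<le> 2 * exp (- 2 * real (card I) * (\<epsilon> / 2)\<^sup>2)"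
      unfolding q using prob_K[OF _ u'] sets_K[OF _ u'] A \<epsilon> I by (intro Hoeffding_indicators_PiM) auto
    finally show ?thesis by (simp add: power_divide)
  qed
  have "measure Q W = (\<integral>u. measure (?K u) W \<partial>\<pi>)"
    by (rule Q) measurable
  also have "\<dots> \<le> (\<integral>u. indicator (space \<pi> - B) u + 2 * exp (- real (card I) * \<epsilon>\<^sup>2 / 2) \<partial>\<pi>)"
  proof (rule integral_mono)
    show "integrable \<pi> (\<lambda>u. measure (?K u) W)"
      using prob_KP
      by (intro integrable_const_bound[where B=1] AE_I2 meas) (auto intro!: prob_space.prob_le_1)
    fix u assume u: "u \<in> space \<pi>"
    \<comment> \<open>On \<open>B\<close> the Hoeffding bound applies; off \<open>B\<close> the
      indicator covers the trivial bound 1.\<close>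
    show "measure (?K u) W \<le> indicator (space \<pi> - B) u + 2 * exp (- real (card I) * \<epsilon>\<^sup>2 / 2)"
      using W[of u] prob_space.prob_le_1[OF prob_KP[OF u], of W] u
      by (cases "u \<in> B") (auto intro: order_trans)
  qed (use int_B in auto)
  also have "\<dots> = measure \<pi> (space \<pi> - B) + 2 * exp (- real (card I) * \<epsilon>\<^sup>2 / 2)"
    by (subst Bochner_Integration.integral_add[OF int_B]) (auto simp: prob_space Int_absorb2)
  finally show ?thesis
    unfolding W_def c_def .
qed

section \<open>Censoring and the coverage of a set forecast\<close>

lemma tobit_eq_max: "tobit s = max 0 s"
  by (auto simp: tobit_def indicator_def max_def)

lemma measurable_tobit [measurable]: "tobit \<in> borel_measurable borel"
  by (simp add: tobit_eq_max[abs_def])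

text \<open>\<open>valid_forecast\<close> compares neighbouring segments only; induction on
  \<open>l\<close> chains these comparisons through \<open>lo S n < hi S n\<close>. Disjointness of
  the segments follows from this.\<close>

lemma valid_forecast_ordered:
  assumes S: "valid_forecast S" and k: "1 \<le> k" "k < l" and l: "l \<le> n_seg S"
  shows "hi S k < lo S l"
proof -
  have "Suc k \<le> l" using k by simp
  then show ?thesis
    using l
  proof (induction l rule: dec_induct)
    case base
    then show ?case using S k(1) by (simp add: valid_forecast_def)
  next
    case (step n)
    then have "hi S k < lo S n" "lo S n < hi S n" "hi S n < lo S (Suc n)"
      using S k(1) by (auto simp: valid_forecast_def)
    then show ?case by simp
  qed
qed

lemma valid_forecast_lo_nonneg:
  assumes S: "valid_forecast S" and k: "1 \<le> k" "k \<le> n_seg S"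
  shows "0 \<le> lo S k"
proof (cases "k = 1")
  case False
  then have "hi S 1 < lo S k"
    using valid_forecast_ordered[OF S, of 1 k] k by simp
  moreover have "0 \<le> lo S 1" "lo S 1 < hi S 1"
    using S k by (auto simp: valid_forecast_def)
  ultimately show ?thesis by simp
qed (use S k in \<open>auto simp: valid_forecast_def\<close>)

lemma sets_forecast_set [measurable]: "forecast_set S \<in> sets borel"
  by (auto simp: forecast_set_def)

text \<open>At \<open>s = 0\<close> the identity fails if \<open>lo S 1 = 0\<close>, because segments 0 and 1 then overlap there.\<close>

lemma indicator_forecast_set_tobit:
  assumes S: "valid_forecast S" and s: "s \<noteq> 0"
  shows "(indicator (forecast_set S) (tobit s) :: real) = (\<Sum>k\<in>segments S. indicator (latent_segment S k) s)"
proof (cases "void S")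
  case True
  then show ?thesis by (simp add: forecast_set_def segments_def)
next
  case False
  have "disjoint_family_on (\<lambda>k. {lo S k..hi S k}) {1..n_seg S}"
    using valid_forecast_ordered[OF S] by (force simp: disjoint_family_on_def neq_iff)
  then have "(indicator (\<Union>k\<in>{1..n_seg S}. {lo S k..hi S k}) s :: real) = (\<Sum>k\<in>{1..n_seg S}. indicator {lo S k..hi S k} s)"
    by (rule indicator_UN_disjoint[OF finite_atLeastAtMost])
  moreover have "(\<Sum>k\<in>segments S. indicator (latent_segment S k) s) =
      (indicator {..0} s + (\<Sum>k\<in>{1..n_seg S}. indicator {lo S k..hi S k} s) :: real)"
    using False by (simp add: segments_def latent_segment_def sum.atLeast_Suc_atMost)
  \<comment> \<open>A negative \<open>s\<close> is censored to 0, which is covered through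
    \<open>{0}\<close>, while no segment reaches below 0; a positive \<open>s\<close> is left as it
    is and can be covered by a segment only.\<close>
  moreover have "(indicator (forecast_set S) (tobit s) :: real) =
      indicator {..0} s + indicator (\<Union>k\<in>{1..n_seg S}. {lo S k..hi S k}) s"
    using False s valid_forecast_lo_nonneg[OF S]
    by (fastforce simp: forecast_set_def tobit_eq_max indicator_def max_def)
  ultimately show ?thesis by simp
qed

text \<open>Pulling back along \<open>tobit\<close> moves the question to the latent scale, where
  the identity of indicators holds off the Lebesgue-null point 0; integrating it against
  \<open>g\<close> gives the sum.\<close>

lemma measure_tobit_forecast_set:
  assumes S: "valid_forecast S" and g: "prob_density g"
  shows "measure (distr (density lborel g) borel tobit) (forecast_set S) =
    (\<Sum>k\<in>segments S. (LINT s:latent_segment S k|lborel. g s))"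
proof -
  have [measurable]: "g \<in> borel_measurable borel" and g0: "\<And>u. 0 \<le> g u"
    using g by (auto simp: prob_density_def)
  have [measurable]: "latent_segment S k \<in> sets borel" for k
    by (simp add: latent_segment_def)
  have int_g: "integrable lborel g"
    using g by (auto simp: prob_density_def intro!: integrableI_nonneg)
  have "measure (distr (density lborel g) borel tobit) (forecast_set S) =
      (\<integral>y. indicator (forecast_set S) y \<partial>distr (density lborel g) borel tobit)"
    by simp
  also have "\<dots> = (\<integral>s. indicator (forecast_set S) (tobit s) \<partial>density lborel g)"
    by (rule integral_distr) auto
  also have "\<dots> = (\<integral>s. g s * indicator (forecast_set S) (tobit s) \<partial>lborel)"
    using g0 by (subst integral_density) auto
  also have "\<dots> = (\<integral>s. (\<Sum>k\<in>segments S. indicator (latent_segment S k) s * g s) \<partial>lborel)"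
  proof (rule integral_cong_AE)
    show "AE s in lborel. g s * indicator (forecast_set S) (tobit s) =
        (\<Sum>k\<in>segments S. indicator (latent_segment S k) s * g s)"
      using AE_lborel_singleton[of "0::real"]
      by eventually_elim (simp add: indicator_forecast_set_tobit[OF S] sum_distrib_left mult.commute)
  qed auto
  also have "\<dots> = (\<Sum>k\<in>segments S. (\<integral>s. indicator (latent_segment S k) s * g s \<partial>lborel))"
    by (rule Bochner_Integration.integral_sum)
       (use integrable_mult_indicator[OF _ int_g] in simp)
  finally show ?thesis
    by (simp add: set_lebesgue_integral_def)
qed

section \<open>Total mass of the laws in the model\<close>

text \<open>As to its size, the final estimate asks of the data law only a mass of at most 1; the
  mass bound for \<open>bind\<close> hands this property from each stage of the model to the
  next.\<close>

lemma subprob_space_bind_weak: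
  assumes M: "subprob_space M" and K: "\<And>x. x \<in> space M \<Longrightarrow> subprob_space (K x)"
    and N: "\<And>x. x \<in> space M \<Longrightarrow> sets (K x) = sets N"
  shows "subprob_space (bind M K)"
proof -
  interpret M: subprob_space M by (rule M)
  obtain x where x: "x \<in> space M"
    using M.subprob_not_empty by auto
  have "sets (bind M K) = sets N"
    using N M.subprob_not_empty by (rule sets_bind)
  then have "space (bind M K) = space (K x)"
    using N[OF x] by (simp cong: sets_eq_imp_space_eq)
  then have "space (bind M K) \<noteq> {}"
    using subprob_space.subprob_not_empty[OF K[OF x]] by simp
  moreover have "emeasure (bind M K) (space (bind M K)) \<le> 1"
    by (rule order_trans[OF emeasure_bind_space_le[OF M.subprob_not_empty K N] M.emeasure_space_le_1])
  ultimately show ?thesis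
    by (intro subprob_spaceI)
qed

text \<open>By its construction, \<open>distr\<close> assigns to a set the mass of the preimage or,
  where this does not define a measure, 0; both are at most 1.\<close>

lemma subprob_space_distr_weak:
  assumes M: "subprob_space M" and N: "space N \<noteq> {}"
  shows "subprob_space (distr M N f)"
proof -
  interpret M: subprob_space M by (rule M)
  show ?thesis
    using N M.subprob_emeasure_le_1 by (intro subprob_spaceI) (auto simp: distr_def emeasure_measure_of_conv)
qed

lemma subprob_space_PiM:
  assumes I: "finite I" and K: "\<And>i. i \<in> I \<Longrightarrow> subprob_space (K i)"
  shows "subprob_space (Pi\<^sub>M I K)"
proof -
  \<comment> \<open>The product depends on the factors in \<open>I\<close> only, but
    \<open>product_sigma_finite\<close> speaks of every index; a one-point space of mass 1 fills the
    remaining ones.\<close>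
  define K' where "K' i = (if i \<in> I then K i else count_space {undefined})" for i
  have K': "subprob_space (K' i)" for i
    using K by (auto simp: K'_def intro!: subprob_spaceI)
  then interpret product_sigma_finite K'
    by (intro product_sigma_finite.intro) (simp add: subprob_space_def finite_measure_def)
  have "Pi\<^sub>M I K = Pi\<^sub>M I K'"
    by (rule PiM_cong) (simp_all add: K'_def)
  moreover have "emeasure (Pi\<^sub>M I K') (space (Pi\<^sub>M I K')) = (\<Prod>i\<in>I. emeasure (K' i) (space (K' i)))"
    unfolding space_PiM by (rule emeasure_PiM[OF I]) simp
  moreover have "\<dots> \<le> 1"
    using subprob_space.emeasure_space_le_1[OF K'] by (intro prod_le_1) auto
  moreover have "space (Pi\<^sub>M I K') \<noteq> {}"
    using subprob_space.subprob_not_empty[OF K'] by (simp add: space_PiM PiE_eq_empty_iff)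
  ultimately show ?thesis
    by (intro subprob_spaceI) auto
qed

lemma path_space_not_empty: "space (path_space n) \<noteq> {}"
  by (simp add: path_space_def space_PiM PiE_eq_empty_iff)

text \<open>For \<open>\<sigma> = 0\<close> the density vanishes, since \<open>1 / 0 = 0\<close>.\<close>

lemma subprob_space_normal_density: "subprob_space (density lborel (normal_density m \<sigma>))"
proof (cases "\<sigma> = 0")
  case True
  then have "normal_density m \<sigma> = (\<lambda>_. 0)"
    by (simp add: normal_density_def fun_eq_iff)
  then show ?thesis
    by (auto intro!: subprob_spaceI simp: emeasure_density)
next
  case False
  moreover have "normal_density m \<sigma> = normal_density m \<bar>\<sigma>\<bar>"
    by (simp add: normal_density_def fun_eq_iff)
  ultimately show ?thesis
    using prob_space_normal_density[of "\<bar>\<sigma>\<bar>" m] by (simp add: prob_space_imp_subprob_space)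
qed

text \<open>The variance component of \<open>u\<close> is arbitrary here. Where it is 0 the normal
  density vanishes and a transition loses all mass, so only a subprobability can be claimed.\<close>

lemma
  shows subprob_space_latent_law: "subprob_space (latent_law x \<theta> u n)" (is ?subprob)
    and sets_latent_law: "sets (latent_law x \<theta> u n) = sets (path_space n)" (is ?sets)
proof -
  have "?subprob \<and> ?sets"
  proof (induction n)
    case 0
    show ?case
      by (auto intro!: prob_space_imp_subprob_space prob_space_return simp: path_space_def space_PiM)
  next
    case (Suc n)
    then have "subprob_space (latent_law x \<theta> u n)" by simp
    moreover have "subprob_space (distr (density lborel g) (path_space (Suc n)) F)"
      if "subprob_space (density lborel g)" for g :: "real \<Rightarrow> ennreal" and F
      using that path_space_not_empty by (rule subprob_space_distr_weak)
    ultimately show ?case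
      by (auto intro!: subprob_space_bind_weak[where N="path_space (Suc n)"] sets_bind
          subprob_space_normal_density subprob_space.subprob_not_empty)
  qed
  then show ?subprob ?sets by auto
qed

lemma sets_data_law:
  "sets (data_law P N) = sets (data_space P N)"
  unfolding data_law_def
  by (rule sets_bind)
     (auto simp: prior_def data_law_given_def data_space_def unit_data_law_def intro!: sets_PiM_cong)

text \<open>The density is a product of a function of \<open>\<theta>\<close> and one of
  \<open>\<xi>\<close>, so Tonelli's theorem splits its integral into two factors equal to
  1.\<close>

lemma subprob_space_prior:
  assumes "tobit_model P"
  shows "subprob_space (prior P)"
proof -
  have pt: "prob_density (prior_theta P)" and px: "prob_density (prior_xi P)"
    using assms by (auto simp: tobit_model_def)
  have [measurable]: "prior_theta P \<in> borel_measurable borel" "prior_xi P \<in> borel_measurable borel"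
    using pt px by (auto simp: prob_density_def)
  define g where "g z = prior_theta P (fst z) * prior_xi P (snd z)" for z
  have "g \<in> borel_measurable (borel \<Otimes>\<^sub>M borel)"
    unfolding g_def[abs_def] by measurable
  moreover have "(\<integral>\<^sup>+z. ennreal (g z) \<partial>lborel) =
      (\<integral>\<^sup>+z. ennreal (prior_theta P (fst z)) * ennreal (prior_xi P (snd z)) \<partial>(lborel \<Otimes>\<^sub>M lborel))"
    using pt by (simp add: lborel_prod g_def prob_density_def ennreal_mult' del: split_paired_All)
  moreover have "\<dots> = (\<integral>\<^sup>+\<theta>. \<integral>\<^sup>+\<xi>. ennreal (prior_theta P \<theta>) * ennreal (prior_xi P \<xi>) \<partial>lborel \<partial>lborel)"
    by (subst lborel.nn_integral_fst[symmetric]) auto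
  moreover have "\<dots> = 1"
    using pt px by (simp add: nn_integral_cmult prob_density_def)
  ultimately have "prob_density g"
    using pt px by (simp add: borel_prod prob_density_def g_def)
  moreover have "prior P = density lborel g"
    by (simp add: prior_def g_def case_prod_beta)
  ultimately show ?thesis
    by (simp add: prob_space_imp_subprob_space prob_space_density_lborel)
qed

lemma subprob_space_unit_law:
  assumes "tobit_model P"
  shows "subprob_space (unit_law P i \<phi>)"
  unfolding unit_law_def
proof (rule subprob_space_bind_weak[OF _ subprob_space_latent_law sets_latent_law])
  show "subprob_space (density lborel (re_density P (regressor P i (- 1)) (snd \<phi>)))"
    using assms by (intro prob_space_imp_subprob_space prob_space_density_lborel) (simp add: tobit_model_def)
qed

lemma subprob_space_data_law:
  assumes P: "tobit_model P"
  shows "subprob_space (data_law P N)"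
  unfolding data_law_def
proof (rule subprob_space_bind_weak[OF subprob_space_prior[OF P], where N="data_space P N"])
  show "subprob_space (data_law_given P N \<phi>)" for \<phi>
    unfolding data_law_given_def unit_data_law_def
    by (intro subprob_space_PiM subprob_space_distr_weak subprob_space_unit_law P path_space_not_empty) simp
  show "sets (data_law_given P N \<phi>) = sets (data_space P N)" for \<phi>
    by (auto simp: data_law_given_def data_space_def unit_data_law_def intro!: sets_PiM_cong)
qed

section \<open>Measurability of the predictive law and of the coverage frequency\<close>

text \<open>The latent density is jointly measurable in one unit's data, the parameter and the
  value. Composition with the coordinate map of unit \<open>i\<close> makes it a kernel on the whole
  panel, and the push-forward along \<open>tobit\<close> keeps it one.\<close>

lemma measurable_future_law:
  assumes f: "latent_forecast_density P i (f i)" and i: "i \<in> {1..N}"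
  shows "(\<lambda>(Y, \<phi>). distr (density lborel (f i (Y i) \<phi>)) borel tobit)
    \<in> data_space P N \<Otimes>\<^sub>M borel \<rightarrow>\<^sub>M prob_algebra borel"
proof -
  have Yi: "(\<lambda>x. fst x i) \<in> data_space P N \<Otimes>\<^sub>M borel \<rightarrow>\<^sub>M path_space (last_obs P)"
    unfolding data_space_def by (rule measurable_compose[OF measurable_fst measurable_component_singleton[OF i]])
  have "(\<lambda>((Y, \<phi>), s). f i Y \<phi> s) \<in> borel_measurable ((path_space (last_obs P) \<Otimes>\<^sub>M borel) \<Otimes>\<^sub>M borel)"
    using f by (simp add: latent_forecast_density_def)
  moreover have "(\<lambda>z. ((fst (fst z) i, snd (fst z)), snd z)) \<in>
      (data_space P N \<Otimes>\<^sub>M borel) \<Otimes>\<^sub>M borel \<rightarrow>\<^sub>M (path_space (last_obs P) \<Otimes>\<^sub>M borel) \<Otimes>\<^sub>M borel"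
    using measurable_compose[OF measurable_fst Yi] by measurable
  ultimately have *: "(\<lambda>(x, s). f i (fst x i) (snd x) s) \<in> borel_measurable ((data_space P N \<Otimes>\<^sub>M borel) \<Otimes>\<^sub>M borel)"
    by (auto dest: measurable_compose[rotated] simp: case_prod_beta)
  have "prob_density (f i (fst x i) (snd x))" if "x \<in> space (data_space P N \<Otimes>\<^sub>M borel)" for x
    using f measurable_space[OF Yi that] unfolding latent_forecast_density_def by blast
  then have "(\<lambda>x. density lborel (f i (fst x i) (snd x))) \<in> data_space P N \<Otimes>\<^sub>M borel \<rightarrow>\<^sub>M prob_algebra borel"
    by (intro measurable_density_lborel *)
  from measurable_compose[OF this measurable_distr_prob_space[OF measurable_tobit]]
  show ?thesis by (simp add: case_prod_beta)
qed

lemma measurable_predictive_law: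
  assumes p: "posterior_density P N p" and f: "\<And>i. i \<in> {1..N} \<Longrightarrow> latent_forecast_density P i (f i)"
  shows "predictive_law N p f \<in> data_space P N \<rightarrow>\<^sub>M prob_algebra (Pi\<^sub>M {1..N} (\<lambda>_. borel))"
  unfolding predictive_law_def[abs_def]
proof (rule measurable_bind_prob_space2)
  show "(\<lambda>Y. density lborel (p Y)) \<in> data_space P N \<rightarrow>\<^sub>M prob_algebra borel"
    using p by (intro measurable_density_lborel) (auto simp: posterior_density_def)
  show "(\<lambda>(Y, \<phi>). Pi\<^sub>M {1..N} (\<lambda>i. distr (density lborel (f i (Y i) \<phi>)) borel tobit))
      \<in> data_space P N \<Otimes>\<^sub>M borel \<rightarrow>\<^sub>M prob_algebra (Pi\<^sub>M {1..N} (\<lambda>_. borel))"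
    using measurable_PiM_prob_algebra[where I="{1..N}" and N="\<lambda>_. borel"
        and K="\<lambda>i (Y, \<phi>). distr (density lborel (f i (Y i) \<phi>)) borel tobit",
        OF finite_atLeastAtMost measurable_future_law[where f=f, OF f]]
    by (simp add: case_prod_beta)
qed

lemma pred_forecast_set:
  assumes "measurable_forecast D S"
  shows "Measurable.pred (D \<Otimes>\<^sub>M borel) (\<lambda>(Y, s). s \<in> forecast_set (S Y))"
proof -
  have [measurable]: "(\<lambda>Y. void (S Y)) \<in> measurable D (count_space UNIV)"
    "(\<lambda>Y. n_seg (S Y)) \<in> measurable D (count_space UNIV)"
    "\<And>k. (\<lambda>Y. lo (S Y) k) \<in> borel_measurable D" "\<And>k. (\<lambda>Y. hi (S Y) k) \<in> borel_measurable D"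
    using assms by (auto simp: measurable_forecast_def)
  \<comment> \<open>The number of segments depends on the data, so the finite union becomes a
    quantifier over all \<open>k\<close> guarded by \<open>k \<le> n_seg\<close>; countable
    quantifiers preserve measurability.\<close>
  have "(\<lambda>(Y, s). s \<in> forecast_set (S Y)) =
      (\<lambda>z. \<not> void (S (fst z)) \<and> (snd z = 0 \<or>
        (\<exists>k. 1 \<le> k \<and> k \<le> n_seg (S (fst z)) \<and> lo (S (fst z)) k \<le> snd z \<and> snd z \<le> hi (S (fst z)) k)))"
    by (auto simp: forecast_set_def fun_eq_iff)
  also have "Measurable.pred (D \<Otimes>\<^sub>M borel) \<dots>"
    by measurable
  finally show ?thesis .
qed

lemma measurable_coverage_frequency:
  assumes "\<And>i. i \<in> {1..N} \<Longrightarrow> measurable_forecast D (\<lambda>Y. S Y i)"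
  shows "(\<lambda>(Y, y). coverage_frequency N (S Y) y) \<in> borel_measurable (D \<Otimes>\<^sub>M Pi\<^sub>M {1..N} (\<lambda>_. borel))"
proof -
  have "(\<lambda>z. indicator (forecast_set (S (fst z) i)) (snd z i) :: real)
      \<in> borel_measurable (D \<Otimes>\<^sub>M Pi\<^sub>M {1..N} (\<lambda>_. borel))" if i: "i \<in> {1..N}" for i
  proof -
    have "(\<lambda>z. (fst z, snd z i)) \<in> D \<Otimes>\<^sub>M Pi\<^sub>M {1..N} (\<lambda>_. borel) \<rightarrow>\<^sub>M D \<Otimes>\<^sub>M (borel :: real measure)"
      using i by measurable
    from measurable_compose[OF this pred_forecast_set[OF assms[OF i]]]
    have "Measurable.pred (D \<Otimes>\<^sub>M Pi\<^sub>M {1..N} (\<lambda>_. borel)) (\<lambda>z. snd z i \<in> forecast_set (S (fst z) i))"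
      by simp
    then show ?thesis
      by (simp add: indicator_def of_bool_def)
  qed
  then show ?thesis
    unfolding coverage_frequency_def case_prod_beta by measurable
qed

section \<open>Concentration of the coverage frequency at fixed data\<close>

text \<open>Through this average both coverage targets enter the argument in the same way; in the
  pointwise case it is the mean of \<open>N\<close> equal terms.\<close>

lemma average_coverage_equality:
  assumes "coverage_equality target \<alpha> N p f Y S" "1 \<le> N"
  shows "(\<Sum>i\<in>{1..N}. measure (unit_predictive_law N p f i Y) (forecast_set (S i))) / real N = 1 - \<alpha>"
  using assms by (cases target) auto

lemma hpd_forecasts_valid:
  assumes "hpd_forecasts target \<alpha> N p f Y S" "i \<in> {1..N}"
  shows "valid_forecast (S i)"
  using assms by (cases target) auto

text \<open>The mixture bound at fixed data \<open>Y\<close>: \<open>\<pi>\<close> is the posterior,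
  \<open>K i\<close> the law of the future observation of unit \<open>i\<close>, \<open>A i\<close>
  its forecast set, and \<open>r\<close> the average Lipschitz constant times the radius
  \<open>d\<close>.\<close>

lemma predictive_coverage_concentration:
  fixes P :: "('b::euclidean_space, 'x::euclidean_space) tobit_panel"
    and p :: "panel_data \<Rightarrow> ('b, 'x) par \<Rightarrow> real"
  assumes N: "1 \<le> N"
    and p: "posterior_density P N p" and f: "\<And>i. i \<in> {1..N} \<Longrightarrow> latent_forecast_density P i (f i)"
    and Y: "Y \<in> space (data_space P N)"
    and S: "\<And>i. i \<in> {1..N} \<Longrightarrow> valid_forecast (S i)"
    and c: "(\<Sum>i\<in>{1..N}. measure (unit_predictive_law N p f i Y) (forecast_set (S i))) / real N = c"
    and B: "B \<in> sets borel" "u0 \<in> B" "\<And>\<phi>. \<phi> \<in> B \<Longrightarrow> norm (\<phi> - u0) \<le> d"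
    and L: "\<And>i k. i \<in> {1..N} \<Longrightarrow> k \<in> segments (S i) \<Longrightarrow>
        (L i k)-lipschitz_on B (segment_prob (f i) (Y i) (S i) k)"
    and \<epsilon>: "0 \<le> \<epsilon>"
      "2 * ((\<Sum>i\<in>{1..N}. \<Sum>k\<in>segments (S i). L i k) / real N * d) + measure (density lborel (p Y)) (- B) \<le> \<epsilon> / 2"
  shows "measure (predictive_law N p f Y)
      {y \<in> space (Pi\<^sub>M {1..N} (\<lambda>_. borel)). \<epsilon> < \<bar>coverage_frequency N S y - c\<bar>}
    \<le> measure (density lborel (p Y)) (- B) + 2 * exp (- real N * \<epsilon>\<^sup>2 / 2)"
proof -
  let ?\<pi> = "density lborel (p Y)"
  define K where "K i \<phi> = distr (density lborel (f i (Y i) \<phi>)) borel tobit" for i \<phi>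
  define q where "q \<phi> = (\<Sum>i\<in>{1..N}. measure (K i \<phi>) (forecast_set (S i))) / real (card {1..N})" for \<phi>
  have \<pi>: "prob_space ?\<pi>"
    using p Y by (intro prob_space_density_lborel) (auto simp: posterior_density_def)
  have K: "K i \<in> ?\<pi> \<rightarrow>\<^sub>M prob_algebra borel" if i: "i \<in> {1..N}" for i
    using measurable_compose[OF measurable_Pair1'[OF Y] measurable_future_law[where f=f, OF f[OF i] i]]
    by (simp add: K_def[abs_def])
  have pred: "predictive_law N p f Y = ?\<pi> \<bind> (\<lambda>\<phi>. Pi\<^sub>M {1..N} (\<lambda>i. K i \<phi>))"
    by (simp add: predictive_law_def K_def)
  have "predictive_law N p f Y \<in> space (prob_algebra (Pi\<^sub>M {1..N} (\<lambda>_. borel)))"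
    by (rule measurable_space[OF measurable_predictive_law[where P=P, OF p f] Y])
  then have sets_pred: "sets (predictive_law N p f Y) = sets (Pi\<^sub>M {1..N} (\<lambda>_. borel))"
    by (simp add: space_prob_algebra)
  \<comment> \<open>The coverage constraint speaks of one-unit marginals; as events of the joint
    predictive law they become the centring terms of the mixture bound.\<close>
  have unit: "measure (unit_predictive_law N p f i Y) (forecast_set (S i)) =
      measure (predictive_law N p f Y) {y \<in> space (Pi\<^sub>M {1..N} (\<lambda>_. borel)). y i \<in> forecast_set (S i)}"
    if i: "i \<in> {1..N}" for i
  proof -
    have "(\<lambda>y. y i) \<in> borel_measurable (predictive_law N p f Y)"
      using measurable_component_singleton[OF i] by (simp cong: measurable_cong_sets add: sets_pred)
    then show ?thesis
      unfolding unit_predictive_law_def using sets_eq_imp_space_eq[OF sets_pred]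
      by (subst measure_distr) (auto intro!: arg_cong[where f="measure _"])
  qed
  have density: "prob_density (f i (Y i) \<phi>)" if i: "i \<in> {1..N}" for i \<phi>
  proof -
    have "Y i \<in> space (path_space (last_obs P))"
      using Y i by (auto simp: data_space_def space_PiM)
    then show ?thesis
      using f[OF i] unfolding latent_forecast_density_def by blast
  qed
  \<comment> \<open>Given the parameter, the coverage probability of a unit is the sum of its
    segment probabilities, so their Lipschitz bounds carry over to \<open>q\<close>.\<close>
  have q: "q \<phi> = (\<Sum>i\<in>{1..N}. \<Sum>k\<in>segments (S i). segment_prob (f i) (Y i) (S i) k \<phi>) / real N" for \<phi>
    by (simp add: q_def K_def segment_prob_def measure_tobit_forecast_set S density)
  have r: "\<bar>q \<phi> - q u0\<bar> \<le> (\<Sum>i\<in>{1..N}. \<Sum>k\<in>segments (S i). L i k) / real N * d" if \<phi>: "\<phi> \<in> B" for \<phi>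
  proof -
    let ?F = "\<lambda>i k. segment_prob (f i) (Y i) (S i) k"
    have F: "\<bar>?F i k \<phi> - ?F i k u0\<bar> \<le> L i k * d" if "i \<in> {1..N}" "k \<in> segments (S i)" for i k
    proof -
      have "\<bar>?F i k \<phi> - ?F i k u0\<bar> \<le> L i k * norm (\<phi> - u0)"
        using lipschitz_onD[OF L[OF that] \<phi> B(2)] by (simp add: dist_norm)
      also have "\<dots> \<le> L i k * d"
        using B(3)[OF \<phi>] lipschitz_on_nonneg[OF L[OF that]] by (rule mult_left_mono)
      finally show ?thesis .
    qed
    have "\<bar>(\<Sum>i\<in>{1..N}. \<Sum>k\<in>segments (S i). ?F i k \<phi> - ?F i k u0)\<bar>
        \<le> (\<Sum>i\<in>{1..N}. \<Sum>k\<in>segments (S i). L i k * d)"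
      by (intro order_trans[OF sum_abs] sum_mono F)
    then show ?thesis
      unfolding q diff_divide_distrib[symmetric] sum_subtractf[symmetric]
      by (simp add: sum_distrib_right divide_right_mono)
  qed
  have "measure (predictive_law N p f Y) {y \<in> space (Pi\<^sub>M {1..N} (\<lambda>_. borel)).
      \<epsilon> < \<bar>(\<Sum>i\<in>{1..N}. indicator (forecast_set (S i)) (y i)) / real (card {1..N})
        - (\<Sum>i\<in>{1..N}. measure (predictive_law N p f Y)
            {y \<in> space (Pi\<^sub>M {1..N} (\<lambda>_. borel)). y i \<in> forecast_set (S i)}) / real (card {1..N})\<bar>}
    \<le> measure ?\<pi> (space ?\<pi> - B) + 2 * exp (- real (card {1..N}) * \<epsilon>\<^sup>2 / 2)"
    unfolding pred
    by (rule mixture_frequency_concentration[OF \<pi> _ _ K _ _ B(2) q_def r])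
       (use N B(1) \<epsilon> in \<open>auto simp: Compl_eq_Diff_UNIV\<close>)
  then show ?thesis
    using c by (simp add: unit coverage_frequency_def Compl_eq_Diff_UNIV)
qed

section \<open>Joint law of data and future observations\<close>

text \<open>The predictive law is a measurable probability kernel on the data space, so the integral
  formula for \<open>bind\<close> applies; what a fixed \<open>Y\<close> contributes is the mass of
  the section of \<open>X\<close> at \<open>Y\<close>.\<close>

lemma
  assumes p: "posterior_density P N p" and f: "\<And>i. i \<in> {1..N} \<Longrightarrow> latent_forecast_density P i (f i)"
  shows sets_data_future_law: "sets (data_future_law P N p f) = sets (data_space P N \<Otimes>\<^sub>M Pi\<^sub>M {1..N} (\<lambda>_. borel))"
    and emeasure_data_future_law: "X \<in> sets (data_space P N \<Otimes>\<^sub>M Pi\<^sub>M {1..N} (\<lambda>_. borel)) \<Longrightarrow>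
      emeasure (data_future_law P N p f) X =
      (\<integral>\<^sup>+Y. emeasure (predictive_law N p f Y) {y \<in> space (Pi\<^sub>M {1..N} (\<lambda>_. borel)). (Y, y) \<in> X} \<partial>data_law P N)"
proof -
  let ?F = "Pi\<^sub>M {1..N} (\<lambda>_. borel :: real measure)"
  have ne: "space (data_law P N) \<noteq> {}"
    using path_space_not_empty by (simp add: sets_eq_imp_space_eq[OF sets_data_law] data_space_def space_PiM PiE_eq_empty_iff)
  have pred: "predictive_law N p f \<in> data_space P N \<rightarrow>\<^sub>M prob_algebra ?F"
    by (rule measurable_predictive_law[OF p f])
  have "(\<lambda>Y. distr (predictive_law N p f Y) (data_space P N \<Otimes>\<^sub>M ?F) (\<lambda>y. (Y, y)))
      \<in> data_space P N \<rightarrow>\<^sub>M prob_algebra (data_space P N \<Otimes>\<^sub>M ?F)"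
    by (rule measurable_distr_prob_space2[OF pred]) simp
  then have K: "(\<lambda>Y. distr (predictive_law N p f Y) (data_space P N \<Otimes>\<^sub>M ?F) (\<lambda>y. (Y, y)))
      \<in> data_law P N \<rightarrow>\<^sub>M subprob_algebra (data_space P N \<Otimes>\<^sub>M ?F)"
    by (intro measurable_prob_algebraD) (simp cong: measurable_cong_sets add: sets_data_law)
  show "sets (data_future_law P N p f) = sets (data_space P N \<Otimes>\<^sub>M ?F)"
    unfolding data_future_law_def by (rule sets_bind_measurable[OF K ne])
  assume X: "X \<in> sets (data_space P N \<Otimes>\<^sub>M ?F)"
  have "emeasure (distr (predictive_law N p f Y) (data_space P N \<Otimes>\<^sub>M ?F) (\<lambda>y. (Y, y))) X =
      emeasure (predictive_law N p f Y) {y \<in> space ?F. (Y, y) \<in> X}" if "Y \<in> space (data_law P N)" for Y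
  proof -
    have Y: "Y \<in> space (data_space P N)"
      using that by (simp add: sets_eq_imp_space_eq[OF sets_data_law])
    have sets: "sets (predictive_law N p f Y) = sets ?F"
      using measurable_space[OF pred Y] by (simp add: space_prob_algebra)
    then have meas: "(\<lambda>y. (Y, y)) \<in> predictive_law N p f Y \<rightarrow>\<^sub>M data_space P N \<Otimes>\<^sub>M ?F"
      using measurable_Pair1'[OF Y] by (simp cong: measurable_cong_sets)
    have "(\<lambda>y. (Y, y)) -` X \<inter> space (predictive_law N p f Y) = {y \<in> space ?F. (Y, y) \<in> X}"
      unfolding sets_eq_imp_space_eq[OF sets] by blast
    then show ?thesis
      by (simp only: emeasure_distr[OF meas X])
  qed
  then show "emeasure (data_future_law P N p f) X =
      (\<integral>\<^sup>+Y. emeasure (predictive_law N p f Y) {y \<in> space ?F. (Y, y) \<in> X} \<partial>data_law P N)"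
    unfolding data_future_law_def by (subst emeasure_bind[OF ne K X]) (rule nn_integral_cong)
qed

section \<open>Convergence in probability of the coverage frequency\<close>

theorem theorem2p1:
  fixes P :: "('b::euclidean_space, 'x::euclidean_space) tobit_panel"
    and \<alpha> :: real
    and p :: "nat \<Rightarrow> panel_data \<Rightarrow> ('b, 'x) par \<Rightarrow> real"
    and f :: "nat \<Rightarrow> (nat \<Rightarrow> real) \<Rightarrow> ('b, 'x) par \<Rightarrow> real \<Rightarrow> real"
    and target :: coverage_target
    and S :: "nat \<Rightarrow> panel_data \<Rightarrow> nat \<Rightarrow> forecast"
    and nbhd :: "nat \<Rightarrow> panel_data \<Rightarrow> ('b, 'x) par set"
    and \<delta> :: "nat \<Rightarrow> panel_data \<Rightarrow> real"
    and L :: "nat \<Rightarrow> panel_data \<Rightarrow> nat \<Rightarrow> nat \<Rightarrow> ('b, 'x) par set \<Rightarrow> real"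
    and avg_L :: "nat \<Rightarrow> panel_data \<Rightarrow> real"
    and M :: real
  assumes alpha: "0 < \<alpha>" "\<alpha> < 1"
    and model: "tobit_model P"
    and posterior: "\<And>N. 1 \<le> N \<Longrightarrow> posterior_density P N (p N)"
    and forecast_density: "\<And>i. 1 \<le> i \<Longrightarrow> latent_forecast_density P i (f i)"
    and forecasts_measurable:
        "\<And>N i. i \<in> {1..N} \<Longrightarrow> measurable_forecast (data_space P N) (\<lambda>Y. S N Y i)"
    and forecasts_hpd:
        "\<And>N. 1 \<le> N \<Longrightarrow> AE Y in data_law P N. hpd_forecasts target \<alpha> N (p N) f Y (S N Y)"
    and unique_mode: "\<And>N. 1 \<le> N \<Longrightarrow> AE Y in data_law P N. unique_posterior_mode P (p N) Y"
    and neighborhoods: "\<And>N. 1 \<le> N \<Longrightarrow> AE Y in data_law P N.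
        compact_neighborhood (param_space P) (posterior_mode P (p N) Y) (nbhd N Y) \<and>
        (\<forall>\<phi>\<in>nbhd N Y. norm (\<phi> - posterior_mode P (p N) Y) \<le> \<delta> N Y)"
    and concentration:
        "conv_in_prob (data_law P) (\<lambda>N Y. measure (density lborel (p N Y)) (- nbhd N Y)) 0"
    and shrinking: "conv_in_prob (data_law P) \<delta> 0"
    and lipschitz: "\<And>N. 1 \<le> N \<Longrightarrow> AE Y in data_law P N.
        \<forall>i\<in>{1..N}. \<forall>k\<in>segments (S N Y i). \<forall>\<phi> B. compact_neighborhood (param_space P) \<phi> B \<longrightarrow>
          (L N Y i k B)-lipschitz_on B (segment_prob (f i) (Y i) (S N Y i) k)"
    and avg_L_eq: "\<And>N Y. avg_L N Y =
        (\<Sum>i\<in>{1..N}. \<Sum>k\<in>segments (S N Y i). L N Y i k (nbhd N Y)) / real N"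
    and avg_L_measurable: "\<And>N. 1 \<le> N \<Longrightarrow> avg_L N \<in> borel_measurable (data_law P N)"
    and avg_L_bounded:
        "(\<lambda>N. measure (data_law P N) {Y \<in> space (data_law P N). avg_L N Y > M}) \<longlonglongrightarrow> 0"
    and coverage: "\<And>N. 1 \<le> N \<Longrightarrow> AE Y in data_law P N. coverage_equality target \<alpha> N (p N) f Y (S N Y)"
  shows "conv_in_prob (\<lambda>N. data_future_law P N (p N) f)
           (\<lambda>N (Y, y). coverage_frequency N (S N Y) y) (1 - \<alpha>)"
proof -
  interpret D: subprob_space "data_law P N" for N
    by (rule subprob_space_data_law[OF model])
  let ?F = "\<lambda>N. Pi\<^sub>M {1..N} (\<lambda>_. borel :: real measure)"
  let ?freq = "\<lambda>N (Y, y). coverage_frequency N (S N Y) y"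
  let ?W = "\<lambda>\<epsilon> N. {z \<in> space (data_space P N \<Otimes>\<^sub>M ?F N). \<epsilon> < \<bar>?freq N z - (1 - \<alpha>)\<bar>}"
  let ?out = "\<lambda>N Y. measure (density lborel (p N Y)) (- nbhd N Y)"
  \<comment> \<open>Exceptional data: too much posterior mass off the neighborhood, too large a
    radius, too large an average Lipschitz constant. The \<open>- 0\<close> reproduces the form of
    \<open>conv_in_prob\<close> with limit 0.\<close>
  let ?A = "\<lambda>\<eta> N. {Y \<in> space (data_law P N). \<eta> < \<bar>?out N Y - 0\<bar>}"
  let ?B = "\<lambda>d N. {Y \<in> space (data_law P N). d < \<bar>\<delta> N Y - 0\<bar>}"
  let ?C = "\<lambda>N. {Y \<in> space (data_law P N). M < avg_L N Y}"
  have freq: "?freq N \<in> borel_measurable (data_space P N \<Otimes>\<^sub>M ?F N)" for N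
    by (rule measurable_coverage_frequency[OF forecasts_measurable])
  have sets_W: "?W \<epsilon> N \<in> sets (data_space P N \<Otimes>\<^sub>M ?F N)" for \<epsilon> N
    using freq[of N] by measurable
  have sets_joint: "sets (data_future_law P N (p N) f) = sets (data_space P N \<Otimes>\<^sub>M ?F N)" if "1 \<le> N" for N
    using that posterior forecast_density by (intro sets_data_future_law) auto
  \<comment> \<open>An inequality for fixed \<open>N\<close> with free tolerances
    \<open>\<eta>\<close> and \<open>d\<close>, which are chosen once \<open>\<epsilon>\<close> and
    the desired accuracy are given.\<close>
  have bound: "measure (data_future_law P N (p N) f) (?W \<epsilon> N)
      \<le> measure (data_law P N) (?A \<eta> N) + measure (data_law P N) (?B d N) + measure (data_law P N) (?C N)
        + (\<eta> + 2 * exp (- real N * \<epsilon>\<^sup>2 / 2))"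
    if N: "1 \<le> N" and meas: "?out N \<in> borel_measurable (data_law P N)" "\<delta> N \<in> borel_measurable (data_law P N)"
      and \<epsilon>: "0 \<le> \<epsilon>" "0 \<le> \<eta>" "0 \<le> d" "2 * (\<bar>M\<bar> * d) + \<eta> \<le> \<epsilon> / 2"
    for N \<epsilon> \<eta> d
  proof -
    let ?h = "\<eta> + 2 * exp (- real N * \<epsilon>\<^sup>2 / 2)"
    let ?ind = "\<lambda>X Y. indicator X Y :: ennreal"
    have sets: "?A \<eta> N \<in> sets (data_law P N)" "?B d N \<in> sets (data_law P N)" "?C N \<in> sets (data_law P N)"
      using meas avg_L_measurable[OF N] by measurable
    \<comment> \<open>For exceptional data one of the indicators is 1 and covers any probability;
      for all other data the bound at fixed data gives \<open>?h\<close>.\<close>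
    have "AE Y in data_law P N. emeasure (predictive_law N (p N) f Y) {y \<in> space (?F N). (Y, y) \<in> ?W \<epsilon> N}
        \<le> ?ind (?A \<eta> N) Y + ?ind (?B d N) Y + ?ind (?C N) Y + ennreal ?h"
      using forecasts_hpd[OF N] neighborhoods[OF N] lipschitz[OF N] coverage[OF N] AE_space
    proof eventually_elim
      case (elim Y)
      have Y: "Y \<in> space (data_space P N)"
        using elim(5) by (simp add: sets_eq_imp_space_eq[OF sets_data_law])
      have "predictive_law N (p N) f Y \<in> space (prob_algebra (?F N))"
        using N posterior forecast_density
        by (intro measurable_space[OF measurable_predictive_law[where P=P] Y]) auto
      then interpret pred: prob_space "predictive_law N (p N) f Y"
        by (simp add: space_prob_algebra)
      show ?case
      proof (cases "Y \<in> ?A \<eta> N \<union> ?B d N \<union> ?C N")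
        case True
        have "emeasure (predictive_law N (p N) f Y) {y \<in> space (?F N). (Y, y) \<in> ?W \<epsilon> N} \<le> 1"
          by (rule pred.emeasure_le_1)
        also have "1 \<le> ?ind (?A \<eta> N) Y + ?ind (?B d N) Y + ?ind (?C N) Y"
          using True by (auto simp: indicator_def)
        also have "\<dots> \<le> \<dots> + ennreal ?h"
          by (rule add_increasing2) auto
        finally show ?thesis .
      next
        case False
        have Y_good: "?out N Y \<le> \<eta>" "\<bar>\<delta> N Y\<bar> \<le> d" "avg_L N Y \<le> M"
          using False elim(5) by auto
        let ?u = "posterior_mode P (p N) Y"
        have nbhd: "compact_neighborhood (param_space P) ?u (nbhd N Y)"
          using elim(2) by simp
        then have u: "?u \<in> nbhd N Y" and closed: "nbhd N Y \<in> sets borel"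
          by (auto simp: compact_neighborhood_def intro: borel_closed compact_imp_closed)
        \<comment> \<open>The Lipschitz hypothesis holds for all compact neighborhoods at once,
          hence also for the data-dependent one around the mode.\<close>
        have Lip: "(L N Y i k (nbhd N Y))-lipschitz_on (nbhd N Y) (segment_prob (f i) (Y i) (S N Y i) k)"
          if "i \<in> {1..N}" "k \<in> segments (S N Y i)" for i k
          using elim(3) nbhd that by blast
        have "0 \<le> avg_L N Y"
          unfolding avg_L_eq using lipschitz_on_nonneg[OF Lip] by (intro divide_nonneg_nonneg sum_nonneg) auto
        \<comment> \<open>The sign of \<open>M\<close> is unspecified, so
          \<open>\<bar>M\<bar>\<close> serves as the bound.\<close>
        then have "avg_L N Y * d \<le> \<bar>M\<bar> * d"
          using Y_good(3) \<epsilon>(3) by (intro mult_right_mono) auto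
        then have small: "2 * (avg_L N Y * d) + ?out N Y \<le> \<epsilon> / 2"
          using \<epsilon>(4) Y_good(1) by linarith
        \<comment> \<open>Off \<open>?B d N\<close> the random radius \<open>\<delta> N Y\<close> is
          at most the constant \<open>d\<close>.\<close>
        have radius: "norm (\<phi> - ?u) \<le> d" if "\<phi> \<in> nbhd N Y" for \<phi>
          using bspec[OF conjunct2[OF elim(2)] that] Y_good(2) by linarith
        have "measure (predictive_law N (p N) f Y)
            {y \<in> space (?F N). \<epsilon> < \<bar>coverage_frequency N (S N Y) y - (1 - \<alpha>)\<bar>}
          \<le> ?out N Y + 2 * exp (- real N * \<epsilon>\<^sup>2 / 2)"
        proof (rule predictive_coverage_concentration[where P=P])
          show "latent_forecast_density P i (f i)" if "i \<in> {1..N}" for i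
            using that forecast_density by simp
        qed (fact N posterior[OF N] Y hpd_forecasts_valid[OF elim(1)] average_coverage_equality[OF elim(4) N]
            closed u radius Lip \<epsilon>(1) small[unfolded avg_L_eq])+
        also have "\<dots> \<le> ?h"
          using Y_good(1) by simp
        also have "{y \<in> space (?F N). \<epsilon> < \<bar>coverage_frequency N (S N Y) y - (1 - \<alpha>)\<bar>} =
            {y \<in> space (?F N). (Y, y) \<in> ?W \<epsilon> N}"
          using Y by (auto simp: space_pair_measure)
        finally have "emeasure (predictive_law N (p N) f Y) {y \<in> space (?F N). (Y, y) \<in> ?W \<epsilon> N} \<le> ennreal ?h"
          unfolding pred.emeasure_eq_measure by (rule ennreal_leI)
        then show ?thesis
          by (rule add_increasing[rotated]) simp
      qed
    qed
    then have "(\<integral>\<^sup>+Y. emeasure (predictive_law N (p N) f Y) {y \<in> space (?F N). (Y, y) \<in> ?W \<epsilon> N} \<partial>data_law P N)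
        \<le> (\<integral>\<^sup>+Y. ?ind (?A \<eta> N) Y + ?ind (?B d N) Y + ?ind (?C N) Y + ennreal ?h \<partial>data_law P N)"
      by (rule nn_integral_mono_AE)
    also have "\<dots> = emeasure (data_law P N) (?A \<eta> N) + emeasure (data_law P N) (?B d N)
        + emeasure (data_law P N) (?C N) + ennreal ?h * emeasure (data_law P N) (space (data_law P N))"
    proof -
      have "(\<integral>\<^sup>+Y. ?ind X Y + ?ind X' Y + ?ind X'' Y + r \<partial>data_law P N) = emeasure (data_law P N) X
          + emeasure (data_law P N) X' + emeasure (data_law P N) X'' + r * emeasure (data_law P N) (space (data_law P N))"
        if "X \<in> sets (data_law P N)" "X' \<in> sets (data_law P N)" "X'' \<in> sets (data_law P N)" for X X' X'' r
        using that by (simp add: nn_integral_add)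
      from this[OF sets] show ?thesis .
    qed
    \<comment> \<open>The constant \<open>?h\<close> was multiplied by the total mass of the data
      law, which is at most 1.\<close>
    also have "\<dots> \<le> emeasure (data_law P N) (?A \<eta> N) + emeasure (data_law P N) (?B d N)
        + emeasure (data_law P N) (?C N) + ennreal ?h * 1"
      using D.emeasure_space_le_1 by (intro add_left_mono mult_left_mono) auto
    also have "\<dots> = ennreal (measure (data_law P N) (?A \<eta> N) + measure (data_law P N) (?B d N)
        + measure (data_law P N) (?C N) + ?h)"
      using \<epsilon>(2) by (simp add: D.emeasure_eq_measure ennreal_plus[symmetric] del: ennreal_plus)
    finally have "emeasure (data_future_law P N (p N) f) (?W \<epsilon> N) \<le> \<dots>"
      using N posterior forecast_density by (subst emeasure_data_future_law[OF _ _ sets_W]) auto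
    then show ?thesis
      unfolding measure_def using \<epsilon>(2) by (intro enn2real_leI) auto
  qed
  show ?thesis
    unfolding conv_in_prob_def
  proof (intro conjI allI impI)
    show "\<forall>\<^sub>F N in sequentially. ?freq N \<in> borel_measurable (data_future_law P N (p N) f)"
      using eventually_ge_at_top[of "1::nat"]
      proof eventually_elim
        case (elim N)
        show ?case
          unfolding measurable_cong_sets[OF sets_joint[OF elim] refl] by (rule freq)
      qed
  next
    fix \<epsilon> :: real assume \<epsilon>: "0 < \<epsilon>"
    show "(\<lambda>N. measure (data_future_law P N (p N) f)
        {z \<in> space (data_future_law P N (p N) f). \<epsilon> < \<bar>?freq N z - (1 - \<alpha>)\<bar>}) \<longlonglongrightarrow> 0"
    proof (rule tendstoI)
      fix e :: real assume e: "0 < e"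
      \<comment> \<open>The bounds \<open>\<eta> \<le> \<epsilon> / 4\<close> and
        \<open>\<bar>M\<bar> * d \<le> \<epsilon> / 8\<close> give the premise of
        \<open>bound\<close>; the \<open>+ 1\<close> in \<open>d\<close> avoids division by 0. Since
        \<open>\<eta>\<close> also appears in the resulting estimate, it is kept below
        \<open>e / 8\<close>: three exceptional events, \<open>\<eta>\<close> and the exponential
        then total less than \<open>e\<close>.\<close>
      define \<eta> where "\<eta> = min (\<epsilon> / 4) (e / 8)"
      define d where "d = \<epsilon> / (8 * (\<bar>M\<bar> + 1))"
      have \<eta>: "0 < \<eta>" "\<eta> \<le> \<epsilon> / 4" "\<eta> \<le> e / 8" and d: "0 < d"
        using \<epsilon> e by (auto simp: \<eta>_def d_def)
      have "\<bar>M\<bar> * d \<le> (\<bar>M\<bar> + 1) * d"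
        using d by simp
      also have "\<dots> = \<epsilon> / 8"
        by (simp add: d_def field_simps)
      finally have Md: "2 * (\<bar>M\<bar> * d) + \<eta> \<le> \<epsilon> / 2"
        using \<eta>(2) by linarith
      have lim_A: "(\<lambda>N. measure (data_law P N) (?A \<eta> N)) \<longlonglongrightarrow> 0"
        and lim_B: "(\<lambda>N. measure (data_law P N) (?B d N)) \<longlonglongrightarrow> 0"
        using concentration shrinking \<eta>(1) d by (simp_all add: conv_in_prob_def)
      have A: "\<forall>\<^sub>F N in sequentially. measure (data_law P N) (?A \<eta> N) < e / 8"
        and B: "\<forall>\<^sub>F N in sequentially. measure (data_law P N) (?B d N) < e / 8"
        using order_tendstoD(2)[OF lim_A, of "e / 8"] order_tendstoD(2)[OF lim_B, of "e / 8"] e by simp_all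
      have C: "\<forall>\<^sub>F N in sequentially. measure (data_law P N) (?C N) < e / 8"
        using order_tendstoD(2)[OF avg_L_bounded, of "e / 8"] e by simp
      have lim_H: "(\<lambda>N. 2 * exp (- real N * \<epsilon>\<^sup>2 / 2)) \<longlonglongrightarrow> 0"
        using \<epsilon> by real_asymp
      have H: "\<forall>\<^sub>F N in sequentially. 2 * exp (- real N * \<epsilon>\<^sup>2 / 2) < e / 8"
        using order_tendstoD(2)[OF lim_H, of "e / 8"] e by simp
      have meas: "\<forall>\<^sub>F N in sequentially. ?out N \<in> borel_measurable (data_law P N)"
        "\<forall>\<^sub>F N in sequentially. \<delta> N \<in> borel_measurable (data_law P N)"
        using concentration shrinking by (simp_all add: conv_in_prob_def)
      show "\<forall>\<^sub>F N in sequentially. dist (measure (data_future_law P N (p N) f)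
          {z \<in> space (data_future_law P N (p N) f). \<epsilon> < \<bar>?freq N z - (1 - \<alpha>)\<bar>}) 0 < e"
        using A B C H meas eventually_ge_at_top[of "1::nat"]
      proof eventually_elim
        case (elim N)
        have "measure (data_future_law P N (p N) f) (?W \<epsilon> N) < e"
          using bound[OF elim(7,5,6) less_imp_le[OF \<epsilon>] less_imp_le[OF \<eta>(1)] less_imp_le[OF d] Md]
            elim(1-4) \<eta>(3) e by linarith
        then show ?case
          by (simp add: sets_eq_imp_space_eq[OF sets_joint[OF elim(7)]])
      qed
    qed
  qed
qed

end
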